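(* Let $C\in\mathcal{C}_d$ be a closed convex cone. For each parameter $\eta\in\mathbb{R}$, $$\mathbb{E}\, e^{\eta(V_C-\delta(C))}\le\exp\left(\frac{e^{2\eta}-2\eta-1}{2}\cdot\delta(C)\right)$$ and $$\mathbb{E}\, e^{\eta(V_C-\delta(C))}\le\exp\left(\frac{e^{-2\eta}+2\eta-1}{2}\cdot\delta(C^\circ)\right).$$
   Context: $\mathbb{R}^d$ carries the standard inner product $\langle\cdot,\cdot\rangle$ and Euclidean norm $\|\cdot\|$. Cones. A convex cone $C\subset\mathbb{R}^d$ is a nonempty set with $\tau(x+y)\in C$ for all $\tau>0$, $x,y\in C$; $\mathcal{C}_d$ is the set of closed convex cones in $\mathbb{R}^d$. The polar cone is $C^\circ=\{u\in\mathbb{R}^d:\langle u,x\rangle\le 0 \text{ for all } x\in C\}\in\mathcal{C}_d$. The metric projector onto $C$ is $\Pi_C(x)=\arg\min\{\|x-y\|^2:y\in C\}$. A cone is polyhedral if it is a finite intersection of halfspaces $\{x:\langle u_i,x\rangle\ge0\}$. A face of a polyhedral cone $C$ is a set of the form $\{x\in C:\langle u,x\rangle=\sup_{y\in C}\langle u,y\rangle\}$ with $u\in C^\circ$; its dimension is the dimension of its linear hull, and its relative interior is its interior relative to its linear hull. Conic Hausdorff metric. For nonzero $x,y$ put $\mathrm{dist}_s(x,y)=\arccos\big(\langle x,y\rangle/(\|x\|\|y\|)\big)$, with $\mathrm{dist}_s(0,0)=0$ and $\mathrm{dist}_s(x,0)=\mathrm{dist}_s(0,x)=\pi/2$ for $x\ne0$.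 Put $\mathcal{T}_s(C,\alpha)=\{x\in\mathbb{R}^d:\mathrm{dist}_s(x,y)\le\alpha\text{ for some }y\in C\}$. The conic Hausdorff metric on $\mathcal{C}_d$ is $\mathrm{dist}_{\mathcal H}(C_1,C_2)=\inf\{\alpha\ge0:\mathcal{T}_s(C_1,\alpha)\supset C_2\text{ and }\mathcal{T}_s(C_2,\alpha)\supset C_1\}$. Conic intrinsic volumes. For polyhedral $C\in\mathcal{C}_d$ and $k=0,\dots,d$, $v_k(C)=\mathbb{P}\{\Pi_C(g)\text{ lies in the relative interior of a }k\text{-dimensional face of }C\}$, with $g$ a standard Gaussian vector in $\mathbb{R}^d$. For general $C\in\mathcal{C}_d$, $v_k(C)=\lim_{i\to\infty}v_k(C_i)$ for any sequence of polyhedral cones $C_i\in\mathcal{C}_d$ with $C_i\to C$ in the conic Hausdorff metric (polyhedral cones are dense, and the limit exists and does not depend on the sequence). The numbers $v_0(C),\dots,v_d(C)$ are nonnegative and sum to one. The intrinsic volume random variable $V_C$ has distribution $\mathbb{P}\{V_C=k\}=v_k(C)$ for $k=0,1,\dots,d$. The statistical dimension is $\delta(C):=\mathbb{E}[V_C]=\sum_{k=0}^d k\,v_k(C)$. *)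

theory Defs
  imports "HOL-Probability.Probability"
begin

definition closed_convex_cone :: "('a::euclidean_space) set \<Rightarrow> bool" where
  "closed_convex_cone C \<longleftrightarrow>
     closed C \<and> C \<noteq> {} \<and> (\<forall>\<tau>>0. \<forall>x\<in>C. \<forall>y\<in>C. \<tau> *\<^sub>R (x + y) \<in> C)"

text \<open>The library's \<open>convex_cone\<close> is closed under scaling by zero as well; for closed sets
  the two notions agree.\<close>

lemma closed_convex_cone_iff_convex_cone:
  "closed_convex_cone C \<longleftrightarrow> closed C \<and> convex_cone C"
proof
  assume C: "closed_convex_cone C"
  then obtain x where x: "x \<in> C" unfolding closed_convex_cone_def by auto
  have add: "\<tau> *\<^sub>R (u + v) \<in> C" if "\<tau> > 0" "u \<in> C" "v \<in> C" for \<tau> u v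
    using C that unfolding closed_convex_cone_def by auto
  have scale: "\<tau> *\<^sub>R u \<in> C" if "\<tau> > 0" "u \<in> C" for \<tau> u
  proof -
    have "(\<tau> / 2) *\<^sub>R (u + u) = \<tau> *\<^sub>R u"
      by (metis field_sum_of_halves scaleR_add_left scaleR_add_right)
    with add[of "\<tau> / 2" u u] that show ?thesis by simp
  qed
  have zero: "0 \<in> C"
  proof (rule closed_sequentially)
    show "closed C" using C unfolding closed_convex_cone_def by blast
    show "(1 / real (Suc n)) *\<^sub>R x \<in> C" for n by (rule scale) (use x in auto)
    have "(\<lambda>n. (1 / real (Suc n)) *\<^sub>R x) \<longlonglongrightarrow> 0 *\<^sub>R x"
      using LIMSEQ_inverse_real_of_nat
      by (intro tendsto_scaleR tendsto_const) (simp only: inverse_eq_divide)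
    then show "(\<lambda>n. (1 / real (Suc n)) *\<^sub>R x) \<longlonglongrightarrow> 0" by simp
  qed
  have "convex_cone C"
    unfolding convex_cone_iff
  proof (intro conjI ballI allI impI)
    show "u + v \<in> C" if "u \<in> C" "v \<in> C" for u v using add[of 1 u v] that by simp
    show "c *\<^sub>R u \<in> C" if "u \<in> C" "c \<ge> 0" for c u
      using scale[of c u] zero that by (cases "c = 0") auto
  qed (rule zero)
  with C show "closed C \<and> convex_cone C" unfolding closed_convex_cone_def by blast
next
  assume "closed C \<and> convex_cone C"
  then show "closed_convex_cone C"
    unfolding closed_convex_cone_def
    by (auto simp: convex_cone_add convex_cone_scaleR convex_cone_nonempty)
qed

definition polar_cone :: "('a::real_inner) set \<Rightarrow> 'a set" where
  "polar_cone C = {u. \<forall>x\<in>C. u \<bullet> x \<le> 0}"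

definition polyhedral_cone :: "('a::euclidean_space) set \<Rightarrow> bool" where
  "polyhedral_cone C \<longleftrightarrow> (\<exists>U. finite U \<and> C = (\<Inter>u\<in>U. {x. u \<bullet> x \<ge> 0}))"

lemma polyhedral_cone_imp_closed_convex_cone:
  "polyhedral_cone C \<Longrightarrow> closed_convex_cone C"
  unfolding polyhedral_cone_def closed_convex_cone_iff_convex_cone
  by (auto intro!: convex_cone_Inter closed_halfspace_ge
      simp: inner_commute convex_cone_halfspace_ge)

definition face_of_cone :: "('a::real_inner) set \<Rightarrow> 'a set \<Rightarrow> bool" where
  "face_of_cone F C \<longleftrightarrow>
     (\<exists>u\<in>polar_cone C. F = {x\<in>C. u \<bullet> x = (SUP y\<in>C. u \<bullet> y)})"

text \<open>Faces of a closed convex cone contain the origin, so that \<open>rel_interior\<close>, which is taken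
  relative to the affine hull, is the interior relative to the linear hull.\<close>

lemma zero_in_face_of_cone:
  assumes "closed_convex_cone C" "face_of_cone F C"
  shows "0 \<in> F"
proof -
  have 0: "0 \<in> C"
    using assms(1) by (simp add: closed_convex_cone_iff_convex_cone convex_cone_contains_0)
  from assms(2) obtain u where u: "u \<in> polar_cone C" "F = {x\<in>C. u \<bullet> x = (SUP y\<in>C. u \<bullet> y)}"
    unfolding face_of_cone_def by auto
  have "(SUP y\<in>C. u \<bullet> y) = 0"
  proof (rule cSup_eq_maximum)
    show "0 \<in> (\<lambda>y. u \<bullet> y) ` C" using 0 by force
  qed (use u(1) in \<open>auto simp: polar_cone_def\<close>)
  with u 0 show ?thesis by simp
qed

lemma face_of_cone_affine_hull:
  assumes "closed_convex_cone C" "face_of_cone F C"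
  shows "affine hull F = span F"
  by (rule affine_hull_span_0) (simp add: zero_in_face_of_cone[OF assms] hull_inc)

definition dist_s :: "'a::real_inner \<Rightarrow> 'a \<Rightarrow> real" where
  "dist_s x y =
     (if x = 0 \<and> y = 0 then 0
      else if x = 0 \<or> y = 0 then pi / 2
      else arccos (x \<bullet> y / (norm x * norm y)))"

definition angular_expansion :: "('a::real_inner) set \<Rightarrow> real \<Rightarrow> 'a set" where
  "angular_expansion C \<alpha> = {x. \<exists>y\<in>C. dist_s x y \<le> \<alpha>}"

definition conic_hausdorff_dist :: "('a::real_inner) set \<Rightarrow> 'a set \<Rightarrow> real" where
  "conic_hausdorff_dist C1 C2 =
     Inf {\<alpha>. \<alpha> \<ge> 0 \<and> C2 \<subseteq> angular_expansion C1 \<alpha> \<and> C1 \<subseteq> angular_expansion C2 \<alpha>}"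

definition std_gaussian :: "(real ^ 'd) measure" where
  "std_gaussian = density lborel (\<lambda>x. ennreal (\<Prod>i\<in>UNIV. std_normal_density (x $ i)))"

text \<open>On closed convex sets, \<open>closest_point C\<close> is the metric projector onto \<open>C\<close>.\<close>

definition polyhedral_intrinsic_volume :: "nat \<Rightarrow> (real ^ 'd) set \<Rightarrow> real" where
  "polyhedral_intrinsic_volume k C =
     measure std_gaussian
       {g. \<exists>F. face_of_cone F C \<and> dim F = k \<and> closest_point C g \<in> rel_interior F}"

text \<open>Polyhedral cones are dense, and the limit below exists and does not depend on the
  approximating sequence.\<close>

definition conic_intrinsic_volume :: "nat \<Rightarrow> (real ^ 'd) set \<Rightarrow> real" where
  "conic_intrinsic_volume k C =
     (if polyhedral_cone C then polyhedral_intrinsic_volume k C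
      else (THE v. \<forall>S. (\<forall>i. polyhedral_cone (S i)) \<and>
                       (\<lambda>i. conic_hausdorff_dist (S i) C) \<longlonglongrightarrow> 0 \<longrightarrow>
                       (\<lambda>i. polyhedral_intrinsic_volume k (S i)) \<longlonglongrightarrow> v))"

text \<open>The law of the intrinsic volume random variable \<open>V\<^sub>C\<close>. The use of \<open>embed_pmf\<close> relies on the
  fact that the intrinsic volumes of a closed convex cone are nonnegative and sum to one.\<close>

definition intrinsic_volume_pmf :: "(real ^ 'd) set \<Rightarrow> nat pmf" where
  "intrinsic_volume_pmf C =
     embed_pmf (\<lambda>k. if k \<le> CARD('d) then conic_intrinsic_volume k C else 0)"

definition statistical_dimension :: "(real ^ 'd) set \<Rightarrow> real" where
  "statistical_dimension C = measure_pmf.expectation (intrinsic_volume_pmf C) real"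

end

(* The Gaussian moment generating function of the squared length of the projection onto C is, after the
   substitution s = (1 - 2 xi)^(-1/2), that is xi = tilt s, the generating polynomial of the intrinsic volumes: on the region
   that projects into a given face the projection is linear, and stretching along the span of the face
   maps that region onto itself. This identity passes to limits in the conic Hausdorff metric (which
   also makes the general intrinsic volumes well defined) and, by rescaling space, turns polarity into
   reversal of the polynomial.

   The exponential bound is dual to Talagrand's transport inequality. If f = a |Pi_C|^2, then its inf-convolution
   with |x - y|^2 / 2 is a / (1 + 2 a) |Pi_C|^2, and Prekopa-Leindler with weights 1 - l and l
   compares the moment generating function at l a / (1 + 2 a) and at - (1 - l) a. Bounding one of the two
   factors below by Jensen and letting l tend to 1 or to 0 gives the upper and the lower tail. *)
theory Submission
  imports Defs
begin

text \<open>With \<open>s = exp \<eta>\<close> the generating polynomial P is the moment generating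
  function of V_C at \<eta>, and \<open>1 - 2 * tilt s = 1 / s^2\<close>. Hence the inequality left
  by the limit in \<open>l\<close>, (1 - 2 tilt s) ln P(s) \<le> \<delta> tilt s, reads ln P \<le>
  \<delta> (exp(2\<eta>) - 1) / 2; subtracting \<eta>\<delta> for the centring gives the stated
  exponent. Jensen serves only as a lower bound, linear in the tilt, for the factor whose tilt
  vanishes in the limit; this is why \<delta> is all that survives of the cone.

  Two obstacles shape the rest. Intrinsic volumes of a general cone are limits without a formula of
  their own, so facts about them are read off the coefficients of a polynomial that agrees with the
  Gaussian integral for all s > 0. And finiteness of exponential moments is not presupposed:
  integrals stay in \<open>ennreal\<close>, and the polynomial identity shows them to be
  finite.\<close>

section \<open>Linear stretching and Lebesgue measure\<close>

lemma nn_integral_lborel_plus: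
  fixes f :: "'a::euclidean_space \<Rightarrow> ennreal"
  assumes [measurable]: "f \<in> borel_measurable borel"
  shows "(\<integral>\<^sup>+x. f (x + a) \<partial>lborel) = (\<integral>\<^sup>+x. f x \<partial>lborel)"
proof -
  have "(\<integral>\<^sup>+x. f x \<partial>lborel) = (\<integral>\<^sup>+x. f x \<partial>distr lborel borel ((+) a))"
    by (simp add: lborel_distr_plus)
  also have "\<dots> = (\<integral>\<^sup>+x. f (x + a) \<partial>lborel)"
    by (subst nn_integral_distr) (simp_all add: add.commute)
  finally show ?thesis by simp
qed

text \<open>Uniqueness of Haar measure in miniature: integrating \<open>f\<close> after
  \<open>T\<close> is translation invariant in \<open>f\<close>, since a shift of \<open>x\<close>
  by \<open>S y\<close> shifts \<open>T x\<close> by \<open>y\<close>. Pairing with the indicator of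
  a ball and exchanging the integrals isolates the factor, which is left unidentified because its
  existence suffices.\<close>

lemma nn_integral_lborel_linear:
  fixes T S :: "'a::euclidean_space \<Rightarrow> 'a"
  assumes T: "linear T" and S: "linear S" and TS: "\<And>x. T (S x) = x"
  obtains m where
    "\<And>f. f \<in> borel_measurable borel \<Longrightarrow> (\<integral>\<^sup>+x. f (T x) \<partial>lborel) = m * (\<integral>\<^sup>+x. f x \<partial>lborel)"
proof
  define B :: "'a set" where "B = ball 0 1"
  let ?g = "indicator B :: 'a \<Rightarrow> ennreal"
  have [measurable]: "B \<in> sets borel" by (simp add: B_def)
  have [measurable]: "T \<in> borel_measurable borel"
    by (intro borel_measurable_continuous_onI linear_continuous_on linear_conv_bounded_linear[THEN iffD1] T)
  have B0: "emeasure lborel B \<noteq> 0" "emeasure lborel B \<noteq> \<infinity>"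
    using content_ball_pos[of 1 "0::'a"] emeasure_lborel_ball_finite[of "0::'a" 1]
    by (auto simp: B_def measure_def)
  fix f :: "'a \<Rightarrow> ennreal" assume [measurable]: "f \<in> borel_measurable borel"
  have "(\<integral>\<^sup>+x. f (T x) \<partial>lborel) * emeasure lborel B
      = (\<integral>\<^sup>+y. (\<integral>\<^sup>+x. f (T x) \<partial>lborel) * ?g y \<partial>lborel)"
    by (simp add: nn_integral_cmult_indicator)
  also have "\<dots> = (\<integral>\<^sup>+y. (\<integral>\<^sup>+x. f (T (x + S y)) \<partial>lborel) * ?g y \<partial>lborel)"
    by (subst nn_integral_lborel_plus) simp_all
  also have "\<dots> = (\<integral>\<^sup>+y. (\<integral>\<^sup>+x. f (T x + y) * ?g y \<partial>lborel) \<partial>lborel)"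
    by (simp add: linear_add[OF T] TS nn_integral_multc)
  also have "\<dots> = (\<integral>\<^sup>+x. (\<integral>\<^sup>+y. f (T x + y) * ?g y \<partial>lborel) \<partial>lborel)"
    by (rule lborel_pair.Fubini') simp
  also have "\<dots> = (\<integral>\<^sup>+x. (\<integral>\<^sup>+y. f y * ?g (y - T x) \<partial>lborel) \<partial>lborel)"
  proof (rule nn_integral_cong)
    fix x
    show "(\<integral>\<^sup>+y. f (T x + y) * ?g y \<partial>lborel) = (\<integral>\<^sup>+y. f y * ?g (y - T x) \<partial>lborel)"
      using nn_integral_lborel_plus[of "\<lambda>y. f y * ?g (y - T x)" "T x"] by (simp add: add.commute)
  qed
  also have "\<dots> = (\<integral>\<^sup>+y. (\<integral>\<^sup>+x. f y * ?g (y - T x) \<partial>lborel) \<partial>lborel)"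
    by (rule lborel_pair.Fubini') simp
  also have "\<dots> = (\<integral>\<^sup>+y. f y * (\<integral>\<^sup>+x. ?g (T x) \<partial>lborel) \<partial>lborel)"
  proof (rule nn_integral_cong)
    fix y
    have "(\<integral>\<^sup>+x. f y * ?g (y - T x) \<partial>lborel) = f y * (\<integral>\<^sup>+x. ?g (y - T x) \<partial>lborel)"
      by (rule nn_integral_cmult) simp
    also have "(\<integral>\<^sup>+x. ?g (y - T x) \<partial>lborel) = (\<integral>\<^sup>+x. ?g (y - T (x + S y)) \<partial>lborel)"
      by (subst nn_integral_lborel_plus) simp_all
    \<comment> \<open>The shift turns \<open>y - T x\<close> into \<open>- T x\<close>, and the ball
      is symmetric.\<close>
    also have "\<dots> = (\<integral>\<^sup>+x. ?g (T x) \<partial>lborel)"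
      by (simp add: linear_add[OF T] TS B_def indicator_def)
    finally show "(\<integral>\<^sup>+x. f y * ?g (y - T x) \<partial>lborel) = f y * (\<integral>\<^sup>+x. ?g (T x) \<partial>lborel)" .
  qed
  also have "\<dots> = (\<integral>\<^sup>+y. f y \<partial>lborel) * (\<integral>\<^sup>+x. ?g (T x) \<partial>lborel)"
    by (rule nn_integral_multc) simp
  finally have eq: "(\<integral>\<^sup>+x. f (T x) \<partial>lborel) * emeasure lborel B =
    (\<integral>\<^sup>+y. f y \<partial>lborel) * (\<integral>\<^sup>+x. ?g (T x) \<partial>lborel)" .
  have "(\<integral>\<^sup>+x. f (T x) \<partial>lborel) = (\<integral>\<^sup>+x. f (T x) \<partial>lborel) * emeasure lborel B / emeasure lborel B"
    using B0 by (simp add: ennreal_mult_divide_eq)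
  then show "(\<integral>\<^sup>+x. f (T x) \<partial>lborel) =
      (\<integral>\<^sup>+x. ?g (T x) \<partial>lborel) / emeasure lborel B * (\<integral>\<^sup>+x. f x \<partial>lborel)"
    unfolding eq by (simp add: ennreal_divide_times ennreal_times_divide mult.commute)
qed

text \<open>For orthonormal \<open>B\<close> this is the linear map that multiplies the component in
  \<open>span B\<close> by \<open>c\<close> and fixes the orthogonal complement.\<close>

definition stretch :: "'a::euclidean_space set \<Rightarrow> real \<Rightarrow> 'a \<Rightarrow> 'a" where
  "stretch B c x = x + (c - 1) *\<^sub>R (\<Sum>v\<in>B. (x \<bullet> v) *\<^sub>R v)"

lemma stretch_measurable [measurable]: "stretch B c \<in> borel_measurable borel"
  unfolding stretch_def by measurable

lemma nn_integral_stretch_Basis: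
  fixes f :: "'a::euclidean_space \<Rightarrow> ennreal"
  assumes [measurable]: "f \<in> borel_measurable borel" and c: "0 < c" and e: "e \<in> Basis"
  shows "ennreal c * (\<integral>\<^sup>+x. f (stretch {e} c x) \<partial>lborel) = (\<integral>\<^sup>+x. f x \<partial>lborel)"
proof -
  define d where "d = (\<lambda>j::'a. if j = e then c else 1)"
  have T: "(\<lambda>x. 0 + (\<Sum>j\<in>Basis. (d j * (x \<bullet> j)) *\<^sub>R j)) = stretch {e} c"
  proof
    fix x :: 'a
    have "(\<Sum>j\<in>Basis. (d j * (x \<bullet> j)) *\<^sub>R j) =
        (\<Sum>j\<in>Basis. (x \<bullet> j) *\<^sub>R j + (if j = e then ((c - 1) * (x \<bullet> j)) *\<^sub>R j else 0))"
      by (intro sum.cong refl) (auto simp: d_def algebra_simps)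
    then show "0 + (\<Sum>j\<in>Basis. (d j * (x \<bullet> j)) *\<^sub>R j) = stretch {e} c x"
      using e by (simp add: sum.distrib euclidean_representation stretch_def)
  qed
  have "(\<Prod>j\<in>Basis. \<bar>d j\<bar>) = c"
    using e c prod.delta[of Basis e "\<lambda>_. c"] by (simp add: d_def if_distrib[of abs] cong: if_cong)
  then have "lborel = density (distr lborel borel (stretch {e} c)) (\<lambda>_. ennreal c)"
    using lborel_affine_euclidean[of d 0] c unfolding T by (simp add: d_def)
  then have "(\<integral>\<^sup>+x. f x \<partial>lborel) =
      (\<integral>\<^sup>+x. f x \<partial>density (distr lborel borel (stretch {e} c)) (\<lambda>_. ennreal c))" by simp
  also have "\<dots> = ennreal c * (\<integral>\<^sup>+x. f (stretch {e} c x) \<partial>lborel)"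
    by (simp add: nn_integral_density nn_integral_distr nn_integral_cmult)
  finally show ?thesis by simp
qed

text \<open>Conjugation with an orthogonal map taking a coordinate vector to \<open>v\<close>
  reduces this to the coordinate case. The unknown factor \<open>m\<close> of the orthogonal map
  enters when \<open>R\<close> is removed and is absorbed when \<open>R\<close> is restored.\<close>

lemma nn_integral_stretch1:
  fixes f :: "real^'n \<Rightarrow> ennreal"
  assumes [measurable]: "f \<in> borel_measurable borel" and c: "0 < c" and v: "norm v = 1"
  shows "ennreal c * (\<integral>\<^sup>+x. f (stretch {v} c x) \<partial>lborel) = (\<integral>\<^sup>+x. f x \<partial>lborel)"
proof -
  obtain e :: "real^'n" where e: "e \<in> Basis" using nonempty_Basis by blast
  obtain Q where Q: "orthogonal_transformation Q" "Q e = v"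
    using orthogonal_transformation_exists_1[of e v] e v by auto
  define R where "R = inv Q"
  have R: "orthogonal_transformation R" unfolding R_def by (rule orthogonal_transformation_inv[OF Q(1)])
  have QR: "Q (R x) = x" for x
    using orthogonal_transformation_surj[OF Q(1)] by (simp add: R_def surj_f_inv_f)
  have lin: "linear Q" "linear R" using Q R by (auto simp: orthogonal_transformation_def)
  have [measurable]: "Q \<in> borel_measurable borel"
    by (intro borel_measurable_continuous_onI linear_continuous_on linear_conv_bounded_linear[THEN iffD1] lin)
  obtain m where m: "\<And>f. f \<in> borel_measurable borel \<Longrightarrow>
      (\<integral>\<^sup>+x. f (R x) \<partial>lborel) = m * (\<integral>\<^sup>+x. f x \<partial>lborel)"
    using nn_integral_lborel_linear[OF lin(2,1)] QR
    by (metis Q(1) R_def inv_f_f orthogonal_transformation_inj)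
  have conj: "stretch {v} c x = Q (stretch {e} c (R x))" for x
  proof -
    have "x \<bullet> v = R x \<bullet> e"
      using Q QR[of x] by (metis orthogonal_transformation_def)
    then show ?thesis
      using lin(1) by (simp add: stretch_def linear_add linear_cmul QR Q(2))
  qed
  have "ennreal c * (\<integral>\<^sup>+x. f (stretch {v} c x) \<partial>lborel) =
      m * (ennreal c * (\<integral>\<^sup>+x. f (Q (stretch {e} c x)) \<partial>lborel))"
    unfolding conj by (subst m) (simp_all add: mult_ac)
  also have "\<dots> = m * (\<integral>\<^sup>+x. f (Q x) \<partial>lborel)"
    by (subst nn_integral_stretch_Basis[of "\<lambda>x. f (Q x)"]) (use c e in simp_all)
  also have "\<dots> = (\<integral>\<^sup>+x. f x \<partial>lborel)"
    by (subst m[symmetric]) (simp_all add: QR)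
  finally show ?thesis .
qed

lemma stretch_insert:
  assumes "finite B" "v \<notin> B" "norm v = 1" "\<And>w. w \<in> B \<Longrightarrow> v \<bullet> w = 0"
  shows "stretch (insert v B) c x = stretch {v} c (stretch B c x)"
proof -
  have "(\<Sum>w\<in>B. (x \<bullet> w) *\<^sub>R w) \<bullet> v = 0"
    unfolding inner_sum_left by (intro sum.neutral) (simp add: assms(4) inner_commute[of _ v])
  then show ?thesis
    using assms by (simp add: stretch_def inner_add_left scaleR_add_right)
qed

lemma nn_integral_stretch:
  fixes f :: "real^'n \<Rightarrow> ennreal"
  assumes "finite B" "pairwise orthogonal B" "\<And>v. v \<in> B \<Longrightarrow> norm v = 1" "0 < c"
    "f \<in> borel_measurable borel"
  shows "ennreal (c ^ card B) * (\<integral>\<^sup>+x. f (stretch B c x) \<partial>lborel) = (\<integral>\<^sup>+x. f x \<partial>lborel)"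
  using assms
proof (induction B arbitrary: f rule: finite_induct)
  case (insert v B)
  note [measurable] = insert.prems(4)
  have orth: "v \<bullet> w = 0" if "w \<in> B" for w
    using insert that by (auto simp: pairwise_def orthogonal_def)
  have "ennreal (c ^ card (insert v B)) * (\<integral>\<^sup>+x. f (stretch (insert v B) c x) \<partial>lborel) =
      ennreal c * (ennreal (c ^ card B) * (\<integral>\<^sup>+x. f (stretch {v} c (stretch B c x)) \<partial>lborel))"
    using insert orth by (simp add: stretch_insert ennreal_mult' mult_ac)
  also have "\<dots> = ennreal c * (\<integral>\<^sup>+x. f (stretch {v} c x) \<partial>lborel)"
    using insert.prems by (subst insert.IH) (auto simp: pairwise_insert)
  also have "\<dots> = (\<integral>\<^sup>+x. f x \<partial>lborel)"
    using insert.prems by (intro nn_integral_stretch1) auto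
  finally show ?case .
qed (simp add: stretch_def)

section \<open>Gaussian measure and projections onto cones\<close>

text \<open>Written through the norm, because every later use compares exponents of stretched,
  dilated or averaged vectors.\<close>

definition gauss_density :: "'a::euclidean_space \<Rightarrow> real" where
  "gauss_density x = (1 / sqrt (2 * pi)) ^ DIM('a) * exp (- (norm x)\<^sup>2 / 2)"

lemma gauss_density_measurable [measurable]: "gauss_density \<in> borel_measurable borel"
  unfolding gauss_density_def by measurable

lemma gauss_density_nonneg [simp]: "0 \<le> gauss_density x"
  by (simp add: gauss_density_def)

lemma gauss_density_eq_prod: "gauss_density x = (\<Prod>b\<in>Basis. std_normal_density (x \<bullet> b))"
proof -
  have "(norm x)\<^sup>2 = (\<Sum>b\<in>Basis. (x \<bullet> b)\<^sup>2)"
    unfolding power2_norm_eq_inner by (subst euclidean_inner) (simp add: power2_eq_square)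
  then have "exp (- (norm x)\<^sup>2 / 2) = (\<Prod>b\<in>Basis. exp (- (x \<bullet> b)\<^sup>2 / 2))"
    by (simp add: exp_sum[symmetric] sum_negf sum_divide_distrib)
  then show ?thesis
    by (simp add: gauss_density_def std_normal_density_def prod_dividef power_divide)
qed

lemma nn_integral_gauss_density:
  "(\<integral>\<^sup>+x. ennreal (gauss_density (x::'a::euclidean_space)) \<partial>lborel) = 1"
proof -
  have "(\<integral>\<^sup>+x. ennreal (gauss_density (x::'a)) \<partial>lborel) =
      (\<integral>\<^sup>+x. (\<Prod>b\<in>Basis. ennreal (std_normal_density ((x::'a) \<bullet> b))) \<partial>lborel)"
    by (simp add: gauss_density_eq_prod prod_ennreal)
  also have "\<dots> = (\<Prod>b\<in>(Basis::'a set). (\<integral>\<^sup>+x. ennreal (std_normal_density x) \<partial>lborel))"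
    by (rule nn_integral_lborel_prod) auto
  also have "(\<integral>\<^sup>+x. ennreal (std_normal_density x) \<partial>lborel) = 1"
    using prob_space.emeasure_space_1[OF prob_space_normal_density[of 1 0]]
    by (simp add: emeasure_density)
  finally show ?thesis by simp
qed

lemma std_gaussian_eq: "std_gaussian = density lborel (\<lambda>x :: real^'d. ennreal (gauss_density x))"
proof -
  have "(\<Prod>i\<in>UNIV. std_normal_density (x $ i)) = gauss_density x" for x :: "real^'d"
  proof -
    have "(norm x)\<^sup>2 = (\<Sum>i\<in>UNIV. (x $ i)\<^sup>2)"
      unfolding power2_norm_eq_inner inner_vec_def by (simp add: power2_eq_square)
    then have "exp (- (norm x)\<^sup>2 / 2) = (\<Prod>i\<in>UNIV. exp (- (x $ i)\<^sup>2 / 2))"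
      by (simp add: exp_sum[symmetric] sum_negf sum_divide_distrib)
    then show ?thesis
      by (simp add: gauss_density_def std_normal_density_def prod_dividef power_divide)
  qed
  then show ?thesis by (simp add: std_gaussian_def)
qed

lemma sets_std_gaussian [simp, measurable_cong]: "sets std_gaussian = sets borel"
  by (simp add: std_gaussian_eq)

lemma space_std_gaussian [simp]: "space std_gaussian = UNIV"
  by (simp add: std_gaussian_eq)

lemma nn_integral_std_gaussian:
  assumes [measurable]: "f \<in> borel_measurable borel"
  shows "(\<integral>\<^sup>+x. f x \<partial>std_gaussian) = (\<integral>\<^sup>+x. ennreal (gauss_density x) * f x \<partial>lborel)"
  unfolding std_gaussian_eq by (rule nn_integral_density) auto

lemma prob_space_std_gaussian: "prob_space (std_gaussian :: (real^'d) measure)"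
  by (rule prob_spaceI)
    (simp add: std_gaussian_eq emeasure_density nn_integral_gauss_density)

section \<open>Metric projection onto a closed convex cone and Moreau's decomposition\<close>

lemma closed_convex_coneD:
  assumes "closed_convex_cone C"
  shows "closed C" "convex_cone C" "convex C" "0 \<in> C" "C \<noteq> {}"
proof -
  show *: "closed C" "convex_cone C" using assms by (simp_all add: closed_convex_cone_iff_convex_cone)
  show "convex C" using *(2) unfolding convex_cone_def by blast
  show "0 \<in> C" using *(2) by (rule convex_cone_contains_0)
  then show "C \<noteq> {}" by blast
qed

text \<open>The variational inequality of the projection onto a convex set, tested at
  \<open>0\<close> and at \<open>2 *\<^sub>R p\<close>, forces the residual to be orthogonal to
  \<open>p\<close>; what remains says that the residual lies in the polar cone. Conversely these
  conditions make the cross term in the expansion of the squared distance nonnegative.\<close>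

lemma closest_point_cone_iff:
  assumes "closed_convex_cone C"
  shows "closest_point C g = p \<longleftrightarrow> p \<in> C \<and> (g - p) \<bullet> p = 0 \<and> (\<forall>y\<in>C. (g - p) \<bullet> y \<le> 0)"
proof -
  note C = closed_convex_coneD(1,2)[OF assms] and conv = closed_convex_coneD(3,5,4)[OF assms]
  show ?thesis
  proof
    assume p: "closest_point C g = p"
    have dot: "(g - p) \<bullet> (x - p) \<le> 0" if "x \<in> C" for x
      using closest_point_dot[OF conv(1) C(1) that, of g] p by simp
    have pC: "p \<in> C" using closest_point_in_set[OF C(1) conv(2)] p by blast
    have "2 *\<^sub>R p \<in> C" using pC C(2) by (simp add: convex_cone_scaleR)
    from dot[OF this] dot[OF conv(3)] have 0: "(g - p) \<bullet> p = 0"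
      by (simp add: scaleR_2 inner_minus_right)
    then show "p \<in> C \<and> (g - p) \<bullet> p = 0 \<and> (\<forall>y\<in>C. (g - p) \<bullet> y \<le> 0)"
      using pC dot by (simp add: inner_diff_right)
  next
    assume p: "p \<in> C \<and> (g - p) \<bullet> p = 0 \<and> (\<forall>y\<in>C. (g - p) \<bullet> y \<le> 0)"
    have "dist g p \<le> dist g z" if "z \<in> C" for z
    proof -
      have "(norm (g - z))\<^sup>2 = (norm (g - p))\<^sup>2 + 2 * ((g - p) \<bullet> (p - z)) + (norm (p - z))\<^sup>2"
        using dot_norm[of "g - p" "p - z"] by simp
      moreover have "(g - p) \<bullet> (p - z) \<ge> 0" using p that by (simp add: inner_diff_right)
      ultimately have "(norm (g - p))\<^sup>2 \<le> (norm (g - z))\<^sup>2" by simp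
      then show ?thesis by (simp add: dist_norm)
    qed
    then show "closest_point C g = p"
      using closest_point_unique[OF conv(1) C(1), of p g] p by simp
  qed
qed

lemma closest_point_cone:
  assumes "closed_convex_cone C"
  shows "closest_point C g \<in> C" "(g - closest_point C g) \<bullet> closest_point C g = 0"
    "y \<in> C \<Longrightarrow> (g - closest_point C g) \<bullet> y \<le> 0"
  using closest_point_cone_iff[OF assms, of g "closest_point C g"] by auto

lemma closest_point_cone_lipschitz:
  assumes "closed_convex_cone C"
  shows "norm (closest_point C x - closest_point C y) \<le> norm (x - y)"
  using closest_point_lipschitz[of C x y] closed_convex_coneD[OF assms] by (simp add: dist_norm)

lemma closest_point_cone_measurable [measurable]:
  assumes "closed_convex_cone C"
  shows "closest_point C \<in> borel_measurable borel"
  using continuous_on_closest_point[of C UNIV] closed_convex_coneD[OF assms]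
  by (intro borel_measurable_continuous_onI) simp

lemma closed_convex_cone_scaleR:
  assumes "closed_convex_cone C" "x \<in> C" "0 \<le> c"
  shows "c *\<^sub>R x \<in> C"
  using closed_convex_coneD(2)[OF assms(1)] assms(2,3) by (simp add: convex_cone_scaleR)

lemma closed_convex_cone_polar:
  fixes C :: "'a::euclidean_space set"
  shows "closed_convex_cone (polar_cone C)"
proof -
  have "polar_cone C = (\<Inter>x\<in>C. {u. x \<bullet> u \<le> 0})"
    by (auto simp: polar_cone_def inner_commute)
  then have "closed (polar_cone C)" by (auto intro!: closed_halfspace_le)
  moreover have "0 \<in> polar_cone C" by (simp add: polar_cone_def)
  moreover have "\<tau> *\<^sub>R (x + y) \<in> polar_cone C"
    if "0 < \<tau>" "x \<in> polar_cone C" "y \<in> polar_cone C" for \<tau> x y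
  proof -
    have "\<tau> * (x \<bullet> z + y \<bullet> z) \<le> 0" if "z \<in> C" for z
      using \<open>0 < \<tau>\<close> \<open>x \<in> polar_cone C\<close> \<open>y \<in> polar_cone C\<close> that
      by (intro mult_nonneg_nonpos add_nonpos_nonpos) (auto simp: polar_cone_def)
    then show ?thesis by (simp add: polar_cone_def inner_add_left)
  qed
  ultimately show ?thesis unfolding closed_convex_cone_def by blast
qed

text \<open>Moreau's decomposition: the conditions of \<open>closest_point_cone_iff\<close> are
  symmetric under exchanging the cone with its polar and the projection with its residual.\<close>

lemma closest_point_polar:
  assumes "closed_convex_cone C"
  shows "closest_point (polar_cone C) g = g - closest_point C g"
  unfolding closest_point_cone_iff[OF closed_convex_cone_polar]
  using closest_point_cone(1,2)[OF assms, of g] closest_point_cone(3)[OF assms, of _ g]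
  by (auto simp: polar_cone_def inner_commute)

lemma norm_closest_point_polar:
  assumes "closed_convex_cone C"
  shows "(norm (closest_point (polar_cone C) g))\<^sup>2 = (norm g)\<^sup>2 - (norm (closest_point C g))\<^sup>2"
proof -
  have "(norm g)\<^sup>2 = (norm (g - closest_point C g))\<^sup>2 + (norm (closest_point C g))\<^sup>2"
    using dot_norm[of "g - closest_point C g" "closest_point C g"] closest_point_cone(2)[OF assms, of g] by simp
  then show ?thesis by (simp add: closest_point_polar[OF assms])
qed

lemma closest_point_cone_scaleR:
  assumes "closed_convex_cone C" "0 \<le> c"
  shows "closest_point C (c *\<^sub>R g) = c *\<^sub>R closest_point C g"
proof -
  have "c *\<^sub>R g - c *\<^sub>R closest_point C g = c *\<^sub>R (g - closest_point C g)"
    by (rule scaleR_diff_right[symmetric])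
  then show ?thesis
    unfolding closest_point_cone_iff[OF assms(1)]
    using closest_point_cone(1,2)[OF assms(1), of g] closest_point_cone(3)[OF assms(1)] assms
      closed_convex_cone_scaleR[OF assms(1) _ assms(2)]
    by (simp add: mult_nonneg_nonpos)
qed

section \<open>Faces of polyhedral cones\<close>

lemma polyhedral_cone_imp_polyhedron: "polyhedral_cone C \<Longrightarrow> polyhedron C"
  unfolding polyhedral_cone_def by (auto intro!: polyhedron_Inter polyhedron_halfspace_ge)

lemma face_of_cone_eq:
  assumes C: "closed_convex_cone C"
  shows "face_of_cone F C \<longleftrightarrow> (\<exists>u\<in>polar_cone C. F = {x\<in>C. u \<bullet> x = 0})"
proof -
  have "(SUP y\<in>C. u \<bullet> y) = 0" if u: "u \<in> polar_cone C" for u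
  proof (rule cSup_eq_maximum)
    show "0 \<in> (\<lambda>y. u \<bullet> y) ` C" using closed_convex_coneD(4)[OF C] by force
  qed (use u in \<open>auto simp: polar_cone_def\<close>)
  then show ?thesis unfolding face_of_cone_def by auto
qed

text \<open>Gives access to the library's theory of faces. Faces of a polyhedron are exposed, and a
  supporting hyperplane of a cone passes through the origin: if it contains \<open>x\<close>, then
  \<open>2 *\<^sub>R x\<close> and \<open>0\<close> lie on its admissible side, so its offset
  \<open>b\<close> is both at most and at least zero.\<close>

lemma face_of_cone_iff:
  assumes "polyhedral_cone C"
  shows "face_of_cone F C \<longleftrightarrow> F face_of C \<and> F \<noteq> {}"
proof
  have C: "closed_convex_cone C" using assms by (rule polyhedral_cone_imp_closed_convex_cone)
  note 0 = closed_convex_coneD(4)[OF C]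
  {
    assume F: "face_of_cone F C"
    then obtain u where u: "u \<in> polar_cone C" "F = C \<inter> {x. u \<bullet> x = 0}"
      using face_of_cone_eq[OF C] by auto
    then have "F face_of C"
      using face_of_Int_supporting_hyperplane_le[OF closed_convex_coneD(3)[OF C], of u 0]
      by (auto simp: polar_cone_def)
    then show "F face_of C \<and> F \<noteq> {}" using zero_in_face_of_cone[OF C F] by blast
  next
    assume F: "F face_of C \<and> F \<noteq> {}"
    then have "F exposed_face_of C"
      using exposed_face_of_polyhedron polyhedral_cone_imp_polyhedron[OF assms] by blast
    then obtain a b where ab: "C \<subseteq> {x. a \<bullet> x \<le> b}" "F = C \<inter> {x. a \<bullet> x = b}"
      unfolding exposed_face_of_def by blast
    obtain x where x: "x \<in> F" using F by blast
    have "2 *\<^sub>R x \<in> C" using closed_convex_cone_scaleR[OF C, of x 2] x ab(2) by auto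
    then have "a \<bullet> (2 *\<^sub>R x) \<le> b" "a \<bullet> x = b" "a \<bullet> 0 \<le> b" using ab x 0 by blast+
    then have "b = 0" by simp
    then have "a \<in> polar_cone C" "F = {x\<in>C. a \<bullet> x = 0}" using ab by (auto simp: polar_cone_def)
    then show "face_of_cone F C" using face_of_cone_eq[OF C] by blast
  }
qed

text \<open>A minimal face containing \<open>p\<close> does the job: \<open>p\<close> lies on none
  of its facets, and the relative interior of a polyhedron is what remains after removing the
  facets.\<close>

lemma exists_face_rel_interior:
  fixes C :: "'a::euclidean_space set"
  assumes "polyhedron C" and p: "p \<in> C"
  obtains F where "F face_of C" "p \<in> rel_interior F"
proof -
  define \<F> where "\<F> = {F. F face_of C \<and> p \<in> F}"
  have "finite \<F>"
    unfolding \<F>_def by (rule finite_subset[OF _ finite_polyhedron_faces[OF assms(1)]]) auto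
  moreover have "C \<in> \<F>"
    using p polyhedron_imp_convex[OF assms(1)] by (simp add: \<F>_def face_of_refl)
  ultimately obtain F where F: "F \<in> \<F>" and min: "\<And>G. G \<in> \<F> \<Longrightarrow> G \<subseteq> F \<Longrightarrow> F = G"
    using finite_has_minimal[of \<F>] by (metis empty_iff)
  have "polyhedron F" using F face_of_polyhedron_polyhedron[OF assms(1)] by (auto simp: \<F>_def)
  moreover have "p \<notin> G" if "G facet_of F" for G
  proof
    assume "p \<in> G"
    have G: "G face_of F" "G \<noteq> F" using that by (auto simp: facet_of_def)
    then have "G \<in> \<F>" using F \<open>p \<in> G\<close> face_of_trans by (auto simp: \<F>_def)
    then show False using min[of G] G face_of_imp_subset by blast
  qed
  ultimately have "p \<in> rel_interior F"
    using F by (auto simp: rel_interior_of_polyhedron \<F>_def)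
  then show thesis using F by (intro that) (auto simp: \<F>_def)
qed

lemma inner_stretch:
  assumes "finite B" "pairwise orthogonal B" "\<And>v. v \<in> B \<Longrightarrow> norm v = 1" "v \<in> B"
  shows "stretch B c x \<bullet> v = c * (x \<bullet> v)"
proof -
  have "(\<Sum>w\<in>B. (x \<bullet> w) *\<^sub>R w) \<bullet> v = (\<Sum>w\<in>B. (x \<bullet> w) * (w \<bullet> v))"
    by (simp add: inner_sum_left)
  also have "\<dots> = (\<Sum>w\<in>B. if w = v then x \<bullet> v else 0)"
    using assms by (intro sum.cong) (auto simp: pairwise_def orthogonal_def norm_eq_1)
  also have "\<dots> = x \<bullet> v" using assms by simp
  finally show ?thesis by (simp add: stretch_def inner_add_left algebra_simps)
qed

lemma stretch_inverse:
  assumes "finite B" "pairwise orthogonal B" "\<And>v. v \<in> B \<Longrightarrow> norm v = 1" "c \<noteq> 0"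
  shows "stretch B (1 / c) (stretch B c x) = x"
proof -
  define y where "y = (\<Sum>v\<in>B. (x \<bullet> v) *\<^sub>R v)"
  have "(\<Sum>v\<in>B. (stretch B c x \<bullet> v) *\<^sub>R v) = c *\<^sub>R y"
    using assms by (simp add: inner_stretch y_def scaleR_sum_right)
  then have "stretch B (1 / c) (stretch B c x) = (x + (c - 1) *\<^sub>R y) + ((1 / c - 1) * c) *\<^sub>R y"
    by (simp add: stretch_def y_def)
  also have "\<dots> = x + ((c - 1) + (1 / c - 1) * c) *\<^sub>R y" by (simp only: scaleR_add_left add.assoc)
  also have "(c - 1) + (1 / c - 1) * c = 0" using assms(4) by (simp add: field_simps)
  finally show ?thesis by simp
qed

lemma rel_interior_face_scaleR:
  assumes C: "closed_convex_cone C" and F: "face_of_cone F C" and c: "0 < c" and p: "p \<in> rel_interior F"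
  shows "c *\<^sub>R p \<in> rel_interior F"
proof -
  obtain u where u: "F = {x\<in>C. u \<bullet> x = 0}" using F face_of_cone_eq[OF C] by auto
  have "(*\<^sub>R) c ` F = F"
  proof
    show "(*\<^sub>R) c ` F \<subseteq> F" using closed_convex_cone_scaleR[OF C] c by (auto simp: u)
    show "F \<subseteq> (*\<^sub>R) c ` F"
    proof
      fix x assume "x \<in> F"
      then have "(1 / c) *\<^sub>R x \<in> F" using closed_convex_cone_scaleR[OF C, of x "1 / c"] c by (auto simp: u)
      then show "x \<in> (*\<^sub>R) c ` F" using c by (force intro: image_eqI[where x="(1 / c) *\<^sub>R x"])
    qed
  qed
  then show ?thesis using rel_interior_scaleR[of c F] c p by (metis image_eqI less_irrefl)
qed

text \<open>The residual is nonpositive on the cone and vanishes at the projection. From any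
  \<open>z\<close> in \<open>F\<close> the segment to the projection can be prolonged a little
  inside \<open>F\<close>, and nonpositivity at the far end forces nonnegativity at
  \<open>z\<close>. So the residual vanishes on \<open>F\<close>, hence on its span.\<close>

lemma closest_point_rel_interior_face:
  assumes C: "closed_convex_cone C" and F: "face_of_cone F C" and p: "closest_point C g \<in> rel_interior F"
    and y: "y \<in> span F"
  shows "(g - closest_point C g) \<bullet> y = 0"
proof -
  define p where "p = closest_point C g"
  obtain u where u: "F = {x\<in>C. u \<bullet> x = 0}" using F face_of_cone_eq[OF C] by auto
  have "convex F"
    unfolding u using convex_Int[OF closed_convex_coneD(3)[OF C] convex_hyperplane[of u 0]] by (simp add: Int_def)
  have "(g - p) \<bullet> z = 0" if z: "z \<in> F" for z
  proof -
    have "F \<noteq> {}" using z by blast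
    then obtain e where e: "e > 1" "(1 - e) *\<^sub>R z + e *\<^sub>R p \<in> F"
      using convex_rel_interior_iff[OF \<open>convex F\<close>, of p] p z by (auto simp: p_def)
    have "(g - p) \<bullet> ((1 - e) *\<^sub>R z + e *\<^sub>R p) \<le> 0"
      unfolding p_def by (rule closest_point_cone(3)[OF C]) (use e u in \<open>auto simp: p_def\<close>)
    then have "(1 - e) * ((g - p) \<bullet> z) \<le> 0"
      using closest_point_cone(2)[OF C, of g] by (simp add: inner_add_right p_def)
    then have "(g - p) \<bullet> z \<ge> 0" using e(1) by (simp add: mult_le_0_iff)
    moreover have "(g - p) \<bullet> z \<le> 0"
      unfolding p_def by (rule closest_point_cone(3)[OF C]) (use z u in auto)
    ultimately show ?thesis by simp
  qed
  then have "F \<subseteq> {y. (g - p) \<bullet> y = 0}" by auto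
  then have "span F \<subseteq> {y. (g - p) \<bullet> y = 0}" by (rule span_minimal) (rule subspace_hyperplane)
  then show ?thesis using y by (auto simp: p_def)
qed

text \<open>On the region that projects into the relative interior of a face, the projection is the
  orthogonal projection onto the span of the face; the region is a cone in both components.\<close>

lemma closest_point_stretch:
  assumes C: "closed_convex_cone C" and F: "face_of_cone F C"
    and B: "finite B" "pairwise orthogonal B" "\<And>v. v \<in> B \<Longrightarrow> norm v = 1" "span B = span F" "B \<subseteq> span F"
    and p: "closest_point C g \<in> rel_interior F" and c: "0 < c"
  shows "stretch B c g = (g - closest_point C g) + c *\<^sub>R closest_point C g"
    and "closest_point C (stretch B c g) = c *\<^sub>R closest_point C g"
    and "closest_point C (stretch B c g) \<in> rel_interior F"
proof -
  let ?p = "closest_point C g"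
  have "?p \<in> F" using p rel_interior_subset by blast
  then have "?p \<in> span B" using B(4) by (simp add: span_base)
  then have "(\<Sum>v\<in>B. (?p \<bullet> v) *\<^sub>R v) = ?p"
    using B by (intro orthonormal_basis_expand) auto
  moreover have "g \<bullet> v = ?p \<bullet> v" if "v \<in> B" for v
    using closest_point_rel_interior_face[OF C F p, of v] that B(5) by (auto simp: inner_diff_left)
  ultimately have "(\<Sum>v\<in>B. (g \<bullet> v) *\<^sub>R v) = ?p" by simp
  then show *: "stretch B c g = (g - ?p) + c *\<^sub>R ?p" by (simp add: stretch_def algebra_simps)
  show "closest_point C (stretch B c g) = c *\<^sub>R ?p"
    unfolding closest_point_cone_iff[OF C] *
    using closest_point_cone(1,2)[OF C, of g] closest_point_cone(3)[OF C, of _ g]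
      closed_convex_cone_scaleR[OF C] c by simp
  then show "closest_point C (stretch B c g) \<in> rel_interior F"
    using rel_interior_face_scaleR[OF C F c p] by simp
qed

lemma sets_face_region [measurable]:
  assumes "closed_convex_cone C"
  shows "{g. closest_point C g \<in> rel_interior F} \<in> sets borel"
proof -
  obtain T where "open T" "rel_interior F = T \<inter> affine hull F"
    using openin_rel_interior[of F] by (auto simp: openin_open Int_commute)
  then have "rel_interior F \<in> sets borel" by (simp add: borel_closed)
  then show ?thesis
    using measurable_sets_borel[OF closest_point_cone_measurable[OF assms]] by (simp add: vimage_def)
qed

text \<open>On \<open>A\<close> the tilted Gaussian density is the Gaussian density at the point
  stretched by \<open>1 / s\<close> along the span of \<open>F\<close>, and \<open>A\<close> is
  invariant under this stretch. Only the Jacobian remains, which contributes one factor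
  \<open>s\<close> for each dimension of \<open>F\<close>.\<close>

lemma nn_integral_face_region:
  fixes C :: "(real^'d) set"
  assumes C: "closed_convex_cone C" and F: "face_of_cone F C" and s: "0 < s"
  defines "A \<equiv> {g. closest_point C g \<in> rel_interior F}"
  shows "(\<integral>\<^sup>+g. ennreal (exp ((1 - 1 / s\<^sup>2) / 2 * (norm (closest_point C g))\<^sup>2)) * indicator A g \<partial>std_gaussian)
    = ennreal (s ^ dim F) * emeasure std_gaussian A"
proof -
  have [measurable]: "A \<in> sets borel" unfolding A_def by (rule sets_face_region[OF C])
  note [measurable] = closest_point_cone_measurable[OF C]
  obtain B where B: "B \<subseteq> span F" "pairwise orthogonal B" "\<And>v. v \<in> B \<Longrightarrow> norm v = 1" "independent B"
    "card B = dim (span F)" "span B = span F"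
    using orthonormal_basis_subspace[of "span F"] by auto
  then have fin: "finite B" by (simp add: independent_imp_finite)
  note B' = fin B(2,3,6,1)
  let ?T = "stretch B (1 / s)"
  have A: "?T g \<in> A \<longleftrightarrow> g \<in> A" for g
  proof
    show "g \<in> A \<Longrightarrow> ?T g \<in> A"
      using closest_point_stretch(3)[OF C F B', of g "1 / s"] s by (simp add: A_def)
    have "stretch B s (?T g) = g"
      using stretch_inverse[OF fin B(2,3), of "1 / s" g] s by simp
    then show "?T g \<in> A \<Longrightarrow> g \<in> A"
      using closest_point_stretch(3)[OF C F B', of "?T g" s] s by (simp add: A_def)
  qed
  have density: "gauss_density g * exp ((1 - 1 / s\<^sup>2) / 2 * (norm (closest_point C g))\<^sup>2) = gauss_density (?T g)"
    if "g \<in> A" for g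
  proof -
    let ?p = "closest_point C g"
    have T: "?T g = (g - ?p) + (1 / s) *\<^sub>R ?p"
      using closest_point_stretch(1)[OF C F B', of g "1 / s"] s that by (simp add: A_def)
    have orth: "(g - ?p) \<bullet> ?p = 0" by (rule closest_point_cone(2)[OF C])
    have "(norm (?T g))\<^sup>2 = (norm (g - ?p))\<^sup>2 + (norm ?p)\<^sup>2 / s\<^sup>2"
      unfolding T using orth by (simp add: norm_add_Pythagorean orthogonal_def power_divide)
    moreover have "(norm g)\<^sup>2 = (norm (g - ?p))\<^sup>2 + (norm ?p)\<^sup>2"
      using norm_add_Pythagorean[of "g - ?p" ?p] orth by (simp add: orthogonal_def)
    ultimately have *: "- (norm (?T g))\<^sup>2 / 2 = - (norm g)\<^sup>2 / 2 + (1 - 1 / s\<^sup>2) / 2 * (norm ?p)\<^sup>2"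
      by (simp add: field_simps)
    show ?thesis unfolding gauss_density_def * exp_add by simp
  qed
  have "(\<integral>\<^sup>+g. ennreal (exp ((1 - 1 / s\<^sup>2) / 2 * (norm (closest_point C g))\<^sup>2)) * indicator A g \<partial>std_gaussian)
      = (\<integral>\<^sup>+g. ennreal (gauss_density (?T g)) * indicator A (?T g) \<partial>lborel)"
    using density by (subst nn_integral_std_gaussian)
      (auto simp: A indicator_def simp flip: ennreal_mult' intro!: nn_integral_cong)
  also have "\<dots> = ennreal (s ^ card B) * (ennreal ((1 / s) ^ card B) *
      (\<integral>\<^sup>+g. ennreal (gauss_density (?T g)) * indicator A (?T g) \<partial>lborel))"
    using s by (simp add: mult.assoc[symmetric] power_divide flip: ennreal_mult')
  also have "\<dots> = ennreal (s ^ card B) * (\<integral>\<^sup>+g. ennreal (gauss_density g) * indicator A g \<partial>lborel)"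
    using s by (subst nn_integral_stretch[OF fin B(2,3)]) auto
  also have "(\<integral>\<^sup>+g. ennreal (gauss_density g) * indicator A g \<partial>lborel) = emeasure std_gaussian A"
    by (subst nn_integral_std_gaussian[symmetric]) auto
  finally show ?thesis using B by simp
qed

section \<open>The moment generating function of the projection\<close>

definition tilt :: "real \<Rightarrow> real" where
  "tilt s = (1 - 1 / s\<^sup>2) / 2"

text \<open>Valued in \<open>ennreal\<close>, so that no integrability has to be known beforehand;
  finiteness for \<open>0 < s\<close> comes out of the polynomial formula.\<close>

definition proj_mgf :: "(real^'d) set \<Rightarrow> real \<Rightarrow> ennreal" where
  "proj_mgf C s = (\<integral>\<^sup>+g. ennreal (exp (tilt s * (norm (closest_point C g))\<^sup>2)) \<partial>std_gaussian)"

text \<open>The regions \<open>A F\<close> partition the space: faces whose relative interiors meet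
  coincide, and each point of a polyhedron lies in the relative interior of some face. Summing the
  contributions of the regions and grouping the faces by dimension gives the polynomial.\<close>

theorem proj_mgf_polyhedral:
  fixes C :: "(real^'d) set"
  assumes "polyhedral_cone C" and s: "0 < s"
  shows "proj_mgf C s = ennreal (\<Sum>k\<le>CARD('d). polyhedral_intrinsic_volume k C * s ^ k)"
proof -
  interpret prob_space "std_gaussian :: (real^'d) measure" by (rule prob_space_std_gaussian)
  have C: "closed_convex_cone C" using assms(1) by (rule polyhedral_cone_imp_closed_convex_cone)
  note [measurable] = closest_point_cone_measurable[OF C]
  define \<F> where "\<F> = {F. face_of_cone F C}"
  define A where "A F = {g. closest_point C g \<in> rel_interior F}" for F
  have [measurable]: "A F \<in> sets borel" for F unfolding A_def by (rule sets_face_region[OF C])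
  have fin: "finite \<F>"
    unfolding \<F>_def face_of_cone_iff[OF assms(1)]
    by (rule finite_subset[OF _ finite_polyhedron_faces[OF polyhedral_cone_imp_polyhedron[OF assms(1)]]]) auto
  have disj: "F = G" if "F \<in> \<F>" "G \<in> \<F>" "g \<in> A F" "g \<in> A G" for F G g
    using that face_of_eq[of F C G] by (auto simp: \<F>_def face_of_cone_iff[OF assms(1)] A_def)
  have ex: "\<exists>F\<in>\<F>. g \<in> A F" for g
  proof -
    obtain F where "F face_of C" "closest_point C g \<in> rel_interior F"
      using exists_face_rel_interior[OF polyhedral_cone_imp_polyhedron[OF assms(1)] closest_point_cone(1)[OF C]] .
    then show ?thesis using rel_interior_subset[of F]
      by (auto simp: \<F>_def face_of_cone_iff[OF assms(1)] A_def)
  qed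
  have one: "(\<Sum>F\<in>\<F>. indicator (A F) g) = (1::ennreal)" for g
  proof -
    obtain F where F: "F \<in> \<F>" "g \<in> A F" using ex by blast
    then have "(\<Sum>G\<in>\<F>. indicator (A G) g) = (\<Sum>G\<in>\<F>. if G = F then 1 else (0::ennreal))"
      using disj by (intro sum.cong) (auto simp: indicator_def)
    then show ?thesis using F fin by simp
  qed
  have vol: "polyhedral_intrinsic_volume k C = (\<Sum>F | F \<in> \<F> \<and> dim F = k. measure std_gaussian (A F))" for k
  proof -
    have "{g. \<exists>F. face_of_cone F C \<and> dim F = k \<and> closest_point C g \<in> rel_interior F} =
        (\<Union>F\<in>{F. F \<in> \<F> \<and> dim F = k}. A F)"
      by (auto simp: \<F>_def A_def)
    then show ?thesis
      unfolding polyhedral_intrinsic_volume_def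
    proof (simp only:, intro finite_measure_finite_Union)
      show "disjoint_family_on A {F. F \<in> \<F> \<and> dim F = k}"
        unfolding disjoint_family_on_def using disj by blast
    qed (use fin in auto)
  qed
  have "proj_mgf C s = (\<integral>\<^sup>+g. (\<Sum>F\<in>\<F>. ennreal (exp (tilt s * (norm (closest_point C g))\<^sup>2)) * indicator (A F) g) \<partial>std_gaussian)"
    unfolding proj_mgf_def by (intro nn_integral_cong) (simp add: one flip: sum_distrib_left)
  also have "\<dots> = (\<Sum>F\<in>\<F>. \<integral>\<^sup>+g. ennreal (exp (tilt s * (norm (closest_point C g))\<^sup>2)) * indicator (A F) g \<partial>std_gaussian)"
    by (rule nn_integral_sum) measurable
  also have "\<dots> = (\<Sum>F\<in>\<F>. ennreal (s ^ dim F) * emeasure std_gaussian (A F))"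
    unfolding tilt_def A_def using nn_integral_face_region[OF C _ s] by (intro sum.cong) (auto simp: \<F>_def)
  also have "\<dots> = ennreal (\<Sum>F\<in>\<F>. measure std_gaussian (A F) * s ^ dim F)"
    using s by (subst sum_ennreal[symmetric])
      (auto simp: emeasure_eq_measure ennreal_mult' mult.commute intro!: sum.cong)
  also have "(\<Sum>F\<in>\<F>. measure std_gaussian (A F) * s ^ dim F) =
      (\<Sum>k\<le>CARD('d). \<Sum>F | F \<in> \<F> \<and> dim F = k. measure std_gaussian (A F) * s ^ dim F)"
    by (rule sum.group[symmetric]) (auto simp: fin dim_subset_UNIV_cart)
  also have "\<dots> = (\<Sum>k\<le>CARD('d). polyhedral_intrinsic_volume k C * s ^ k)"
    unfolding vol sum_distrib_right by (intro sum.cong refl) auto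
  finally show ?thesis .
qed

text \<open>By Moreau's decomposition the exponent contains \<open>tilt s * (norm g)^2\<close>,
  which turns the Gaussian exponent into that of \<open>g / s\<close>. The remaining term fits
  because \<open>tilt (1 / s) = - (s^2) * tilt s\<close>, and the dilation contributes its
  Jacobian.\<close>

lemma proj_mgf_polar:
  fixes C :: "(real^'d) set"
  assumes C: "closed_convex_cone C" and s: "0 < s"
  shows "proj_mgf (polar_cone C) s = ennreal (s ^ CARD('d)) * proj_mgf C (1 / s)"
proof -
  note [measurable] = closest_point_cone_measurable[OF C] closest_point_cone_measurable[OF closed_convex_cone_polar[of C]]
  let ?f = "\<lambda>h. ennreal (gauss_density h) * ennreal (exp (tilt (1 / s) * (norm (closest_point C h))\<^sup>2))"
  have stretch: "stretch Basis (1 / s) x = (1 / s) *\<^sub>R x" for x :: "real^'d"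
    by (simp add: stretch_def euclidean_representation algebra_simps)
  have eq: "gauss_density g * exp (tilt s * (norm (closest_point (polar_cone C) g))\<^sup>2) =
      gauss_density ((1 / s) *\<^sub>R g) * exp (tilt (1 / s) * (norm (closest_point C ((1 / s) *\<^sub>R g)))\<^sup>2)" for g
  proof -
    have "- (norm g)\<^sup>2 / 2 + tilt s * (norm (closest_point (polar_cone C) g))\<^sup>2 =
        - (norm ((1 / s) *\<^sub>R g))\<^sup>2 / 2 + tilt (1 / s) * (norm (closest_point C ((1 / s) *\<^sub>R g)))\<^sup>2"
      using s unfolding norm_closest_point_polar[OF C]
      by (simp add: closest_point_cone_scaleR[OF C] tilt_def power_divide field_simps power2_eq_square)
    then show ?thesis by (simp add: gauss_density_def flip: exp_add)
  qed
  have "proj_mgf (polar_cone C) s = (\<integral>\<^sup>+g. ?f (stretch Basis (1 / s) g) \<partial>lborel)"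
    unfolding proj_mgf_def stretch using eq
    by (subst nn_integral_std_gaussian) (auto simp flip: ennreal_mult' intro!: nn_integral_cong)
  also have "\<dots> = ennreal (s ^ CARD('d)) * (ennreal ((1 / s) ^ card (Basis :: (real^'d) set)) *
      (\<integral>\<^sup>+g. ?f (stretch Basis (1 / s) g) \<partial>lborel))"
    using s by (simp add: mult.assoc[symmetric] power_divide flip: ennreal_mult')
  also have "\<dots> = ennreal (s ^ CARD('d)) * (\<integral>\<^sup>+g. ?f g \<partial>lborel)"
    using s by (subst nn_integral_stretch) (auto simp: pairwise_def orthogonal_def inner_Basis)
  also have "(\<integral>\<^sup>+g. ?f g \<partial>lborel) = proj_mgf C (1 / s)"
    unfolding proj_mgf_def by (subst nn_integral_std_gaussian) auto
  finally show ?thesis .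
qed

section \<open>Continuity of the projection integral in the conic Hausdorff metric\<close>

lemma infdist_le_of_dist_s:
  assumes D: "closed_convex_cone D" and y: "y \<in> D" "dist_s x y \<le> \<alpha>" and \<alpha>: "\<alpha> < pi / 2"
  shows "infdist x D \<le> \<alpha> * norm x"
proof (cases "x = 0")
  case True
  then show ?thesis using closed_convex_coneD(4)[OF D] by simp
next
  case False
  then have y0: "y \<noteq> 0" using y(2) \<alpha> by (auto simp: dist_s_def)
  define z where "z = x \<bullet> y / (norm x * norm y)"
  define \<theta> where "\<theta> = arccos z"
  have \<theta>: "\<theta> \<le> \<alpha>" using y(2) False y0 by (simp add: dist_s_def \<theta>_def z_def)
  have "\<bar>z\<bar> \<le> 1" using Cauchy_Schwarz_ineq2[of x y] False y0 by (simp add: z_def abs_mult)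
  then have z: "-1 \<le> z" "z \<le> 1" by auto
  have cos: "cos \<theta> = z" and range: "0 \<le> \<theta>" "\<theta> \<le> pi"
    using z by (auto simp: \<theta>_def arccos_lbound arccos_ubound)
  \<comment> \<open>An angle below \<open>pi / 2\<close> puts the foot of the perpendicular from
    \<open>x\<close> to the line through \<open>y\<close> on the ray of \<open>y\<close>, hence in
    \<open>D\<close>. The same bound has already excluded \<open>y = 0\<close>, where
    \<open>dist_s\<close> equals \<open>pi / 2\<close> by convention.\<close>
  have "0 \<le> z" using cos_ge_zero[of \<theta>] \<theta> \<alpha> range cos by simp
  moreover have "x \<bullet> y = z * (norm x * norm y)" using False y0 by (simp add: z_def)
  ultimately have nn: "0 \<le> x \<bullet> y" by simp
  define t where "t = (x \<bullet> y) / (norm y)\<^sup>2"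
  have "t *\<^sub>R y \<in> D" using nn y(1) D by (intro closed_convex_cone_scaleR) (auto simp: t_def)
  then have "infdist x D \<le> norm (x - t *\<^sub>R y)" by (metis dist_norm infdist_le)
  also have "norm (x - t *\<^sub>R y) = norm x * sin \<theta>"
  proof (rule power2_eq_imp_eq)
    have "(norm (x - t *\<^sub>R y))\<^sup>2 = (norm x)\<^sup>2 - 2 * t * (x \<bullet> y) + t\<^sup>2 * (norm y)\<^sup>2"
      unfolding power2_norm_eq_inner
      by (simp add: inner_diff_left inner_diff_right inner_commute power2_eq_square algebra_simps)
    also have "\<dots> = (norm x)\<^sup>2 * (1 - z\<^sup>2)"
      using False y0 by (simp add: t_def z_def power2_eq_square field_simps)
    also have "\<dots> = (norm x * sin \<theta>)\<^sup>2"
      by (simp add: power_mult_distrib sin_squared_eq cos)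
    finally show "(norm (x - t *\<^sub>R y))\<^sup>2 = (norm x * sin \<theta>)\<^sup>2" .
    show "0 \<le> norm x * sin \<theta>" using range by (simp add: sin_ge_zero)
  qed simp
  also have "\<dots> \<le> norm x * \<alpha>"
    using sin_x_le_x[of \<theta>] range \<theta> by (intro mult_left_mono) auto
  finally show ?thesis by (simp add: mult.commute)
qed

lemma norm_closest_point_cone:
  assumes C: "closed_convex_cone C"
  shows "(norm (closest_point C g))\<^sup>2 = (norm g)\<^sup>2 - (infdist g C)\<^sup>2"
proof -
  have "infdist g C = norm (g - closest_point C g)"
    using setdist_closest_point[of C g] closed_convex_coneD[OF C] by (simp add: infdist_eq_setdist dist_norm)
  moreover have "(norm g)\<^sup>2 = (norm (g - closest_point C g))\<^sup>2 + (norm (closest_point C g))\<^sup>2"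
    using norm_add_Pythagorean[of "g - closest_point C g" "closest_point C g"] closest_point_cone(2)[OF C, of g]
    by (simp add: orthogonal_def)
  ultimately show ?thesis by simp
qed

lemma norm_closest_point_cone_le:
  assumes "closed_convex_cone C"
  shows "norm (closest_point C g) \<le> norm g"
  by (rule power2_le_imp_le) (use norm_closest_point_cone[OF assms, of g] in simp_all)

lemma infdist_cone_mono:
  assumes C: "closed_convex_cone C" and D: "closed_convex_cone D" and \<alpha>: "\<alpha> < pi / 2" "0 \<le> \<alpha>"
    and sub: "C \<subseteq> angular_expansion D \<alpha>"
  shows "infdist g D \<le> infdist g C + \<alpha> * norm g"
proof -
  let ?p = "closest_point C g"
  have "?p \<in> angular_expansion D \<alpha>" using closest_point_cone(1)[OF C] sub by blast
  then have "infdist ?p D \<le> \<alpha> * norm ?p"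
    using infdist_le_of_dist_s[OF D _ _ \<alpha>(1)] by (auto simp: angular_expansion_def)
  also have "\<dots> \<le> \<alpha> * norm g" using \<alpha>(2) norm_closest_point_cone_le[OF C] by (intro mult_left_mono)
  finally show ?thesis
    using infdist_triangle[of g D ?p] setdist_closest_point[of C g] closed_convex_coneD[OF C]
    by (simp add: infdist_eq_setdist)
qed

text \<open>The vertex of a cone is within \<open>pi / 2\<close> of every vector, so the infimum
  defining the metric is never taken over the empty set.\<close>

lemma conic_hausdorff_set_nonempty:
  assumes C: "closed_convex_cone C" and D: "closed_convex_cone D"
  shows "pi \<in> {\<alpha>. \<alpha> \<ge> 0 \<and> D \<subseteq> angular_expansion C \<alpha> \<and> C \<subseteq> angular_expansion D \<alpha>}"
proof -
  have "x \<in> angular_expansion E pi" if "closed_convex_cone E" for x :: 'a and E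
    using closed_convex_coneD(4)[OF that] by (auto simp: angular_expansion_def dist_s_def intro!: bexI[of _ 0])
  then show ?thesis using C D by auto
qed

lemma abs_infdist_diff_le:
  assumes C: "closed_convex_cone C" and D: "closed_convex_cone D"
    and e: "conic_hausdorff_dist C D < e" "e \<le> pi / 2"
  shows "\<bar>infdist g C - infdist g D\<bar> \<le> e * norm g"
proof -
  let ?S = "{\<alpha>. \<alpha> \<ge> 0 \<and> D \<subseteq> angular_expansion C \<alpha> \<and> C \<subseteq> angular_expansion D \<alpha>}"
  have "?S \<noteq> {}" using conic_hausdorff_set_nonempty[OF C D] by blast
  then obtain \<alpha> where \<alpha>: "\<alpha> \<in> ?S" "\<alpha> < e"
    using e(1) cInf_lessD[of ?S e] unfolding conic_hausdorff_dist_def by blast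
  have "infdist g D \<le> infdist g C + \<alpha> * norm g" "infdist g C \<le> infdist g D + \<alpha> * norm g"
    using infdist_cone_mono[OF C D] infdist_cone_mono[OF D C] \<alpha> e(2) by auto
  moreover have "\<alpha> * norm g \<le> e * norm g" using \<alpha>(2) by (intro mult_right_mono) auto
  ultimately show ?thesis by linarith
qed

lemma tendsto_infdist_cone:
  assumes S: "\<And>i. closed_convex_cone (S i)" and C: "closed_convex_cone C"
    and lim: "(\<lambda>i. conic_hausdorff_dist (S i) C) \<longlonglongrightarrow> 0"
  shows "(\<lambda>i. infdist g (S i)) \<longlonglongrightarrow> infdist g C"
proof (rule LIMSEQ_I)
  fix r :: real assume r: "0 < r"
  \<comment> \<open>The cap \<open>pi / 2\<close> is the range in which angles control distances;
    the summand 1 avoids division by zero at \<open>g = 0\<close>.\<close>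
  define e where "e = min (pi / 2) (r / (2 * (norm g + 1)))"
  have "0 < r / (2 * (norm g + 1))" using r by (simp add: add_nonneg_pos)
  then have "0 < e" by (simp add: e_def)
  moreover have "e \<le> pi / 2" unfolding e_def by (rule min.cobounded1)
  ultimately have e: "0 < e" "e \<le> pi / 2" by simp_all
  have "e * norm g \<le> r / (2 * (norm g + 1)) * (norm g + 1)"
    using e r by (intro mult_mono) (auto simp: e_def)
  also have "\<dots> = r / 2" by (simp add: field_simps add_nonneg_eq_0_iff)
  finally have er: "e * norm g < r" using r by simp
  have "eventually (\<lambda>i. conic_hausdorff_dist (S i) C < e) sequentially"
    using order_tendstoD(2)[OF lim e(1)] .
  then obtain N where N: "\<And>i. i \<ge> N \<Longrightarrow> conic_hausdorff_dist (S i) C < e"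
    by (auto simp: eventually_sequentially)
  show "\<exists>N. \<forall>i\<ge>N. norm (infdist g (S i) - infdist g C) < r"
    using abs_infdist_diff_le[OF S C N e(2)] er by (auto intro!: exI[of _ N] le_less_trans[OF _ er])
qed

text \<open>Dominated convergence. The squared norm of the projection is the squared norm minus the
  squared distance, so pointwise convergence follows from that of the distances. The summand 1 of
  the majorant covers negative tilts, the exponential covers positive ones.\<close>

lemma tendsto_proj_mgf:
  fixes C :: "(real^'d) set"
  assumes S: "\<And>i. closed_convex_cone (S i)" and C: "closed_convex_cone C"
    and lim: "(\<lambda>i. conic_hausdorff_dist (S i) C) \<longlonglongrightarrow> 0" and s: "0 < s"
  shows "(\<lambda>i. proj_mgf (S i) s) \<longlonglongrightarrow> proj_mgf C s"
proof -
  interpret prob_space "std_gaussian :: (real^'d) measure" by (rule prob_space_std_gaussian)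
  note [measurable] = closest_point_cone_measurable[OF C] closest_point_cone_measurable[OF S]
  \<comment> \<open>The whole space is the empty intersection of halfspaces and projects
    identically, so the polynomial formula bounds the integral of the majorant.\<close>
  have "polyhedral_cone (UNIV :: (real^'d) set)" unfolding polyhedral_cone_def by (intro exI[of _ "{}"]) auto
  from proj_mgf_polyhedral[OF this s]
  have fin: "(\<integral>\<^sup>+(g::real^'d). ennreal (exp (tilt s * (norm g)\<^sup>2)) \<partial>std_gaussian) < \<infinity>"
    by (simp add: proj_mgf_def closest_point_self)
  show ?thesis
    unfolding proj_mgf_def
  proof (rule nn_integral_dominated_convergence)
    show "(\<integral>\<^sup>+(g::real^'d). (1 + ennreal (exp (tilt s * (norm g)\<^sup>2))) \<partial>std_gaussian) < \<infinity>"
      using fin by (subst nn_integral_add) (auto simp: emeasure_space_1[simplified])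
    show "AE g in std_gaussian. (\<lambda>i. ennreal (exp (tilt s * (norm (closest_point (S i) g))\<^sup>2)))
        \<longlonglongrightarrow> ennreal (exp (tilt s * (norm (closest_point C g))\<^sup>2))"
      unfolding norm_closest_point_cone[OF S] norm_closest_point_cone[OF C]
      by (intro AE_I2 tendsto_ennrealI tendsto_intros tendsto_infdist_cone[OF S C lim])
    fix i
    have "ennreal (exp (tilt s * (norm (closest_point (S i) g))\<^sup>2)) \<le> 1 + ennreal (exp (tilt s * (norm g)\<^sup>2))" for g
    proof -
      have "(norm (closest_point (S i) g))\<^sup>2 \<le> (norm g)\<^sup>2"
        using norm_closest_point_cone_le[OF S] by (intro power_mono) auto
      then have "tilt s * (norm (closest_point (S i) g))\<^sup>2 \<le> max 0 (tilt s * (norm g)\<^sup>2)"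
        by (cases "0 \<le> tilt s") (auto simp: mult_nonpos_nonneg max.coboundedI1 intro!: max.coboundedI2 mult_left_mono)
      then have "exp (tilt s * (norm (closest_point (S i) g))\<^sup>2) \<le> max (exp 0) (exp (tilt s * (norm g)\<^sup>2))"
        by (auto simp: max_def split: if_splits)
      also have "\<dots> \<le> 1 + exp (tilt s * (norm g)\<^sup>2)" by simp
      finally show ?thesis by (simp flip: ennreal_1 ennreal_plus)
    qed
    then show "AE g in std_gaussian. ennreal (exp (tilt s * (norm (closest_point (S i) g))\<^sup>2))
        \<le> 1 + ennreal (exp (tilt s * (norm g)\<^sup>2))" by simp
  qed measurable
qed

section \<open>Intrinsic volumes of general cones\<close>

text \<open>Every offset \<open>b h\<close> may be replaced by zero: it is nonnegative because of
  the origin, and a point of the cone with \<open>a h \<bullet> x > 0\<close> could be scaled until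
  it violates the original inequality.\<close>

lemma polyhedron_convex_cone_imp_polyhedral_cone:
  assumes "polyhedron S" "convex_cone S"
  shows "polyhedral_cone S"
proof -
  obtain H where H: "finite H" "S = \<Inter>H" "\<forall>h\<in>H. \<exists>a b. a \<noteq> 0 \<and> h = {x. a \<bullet> x \<le> b}"
    using assms(1) unfolding polyhedron_def by blast
  then obtain a b where ab: "\<And>h. h \<in> H \<Longrightarrow> h = {x. a h \<bullet> x \<le> b h}" by metis
  have S: "x \<in> S \<longleftrightarrow> (\<forall>h\<in>H. a h \<bullet> x \<le> b h)" for x using H(2) ab by blast
  have b: "0 \<le> b h" if "h \<in> H" for h
    using convex_cone_contains_0[OF assms(2)] S[of 0] that by auto
  have "a h \<bullet> x \<le> 0" if x: "x \<in> S" and h: "h \<in> H" for x h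
  proof (rule ccontr)
    assume "\<not> a h \<bullet> x \<le> 0"
    then have pos: "0 < a h \<bullet> x" by simp
    have "((b h + 1) / (a h \<bullet> x)) *\<^sub>R x \<in> S"
      using assms(2) x pos b[OF h] by (intro convex_cone_scaleR) auto
    then have "a h \<bullet> (((b h + 1) / (a h \<bullet> x)) *\<^sub>R x) \<le> b h" using S h by blast
    then show False using pos by simp
  qed
  moreover have "x \<in> S" if "\<And>h. h \<in> H \<Longrightarrow> a h \<bullet> x \<le> 0" for x
    using that b S by force
  ultimately have "S = (\<Inter>u\<in>(\<lambda>h. - a h) ` H. {x. u \<bullet> x \<ge> 0})" by auto
  then show ?thesis unfolding polyhedral_cone_def using H(1) by blast
qed

text \<open>The approximant is generated by a finite net of the unit vectors of \<open>C\<close>. It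
  lies inside \<open>C\<close>, so only the inclusion of \<open>C\<close> in its angular expansion
  has content.\<close>

lemma exists_polyhedral_approximation:
  fixes C :: "'a::euclidean_space set"
  assumes C: "closed_convex_cone C" and e: "0 < e" "e \<le> pi"
  obtains S where "polyhedral_cone S" "conic_hausdorff_dist S C \<le> e"
proof -
  \<comment> \<open>The chord of the unit circle that subtends the angle \<open>e\<close>.\<close>
  define \<delta> where "\<delta> = sqrt (2 * (1 - cos e))"
  have "cos e < 1" using cos_monotone_0_pi[of 0 e] e by simp
  then have \<delta>: "0 < \<delta>" "\<delta>\<^sup>2 = 2 * (1 - cos e)" by (simp_all add: \<delta>_def)
  have "compact (C \<inter> sphere 0 1)"
    using closed_convex_coneD(1)[OF C] by (simp add: closed_Int_compact)
  then obtain K where K: "finite K" "K \<subseteq> C \<inter> sphere 0 1" "C \<inter> sphere 0 1 \<subseteq> (\<Union>x\<in>K. ball x \<delta>)"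
    using seq_compact_imp_totally_bounded \<delta>(1) by (metis compact_imp_seq_compact)
  define S where "S = convex_cone hull K"
  have cone: "convex_cone S" unfolding S_def by (rule convex_cone_convex_cone_hull)
  have poly: "polyhedral_cone S"
    using polyhedron_convex_cone_hull[OF K(1)] cone
    unfolding S_def by (rule polyhedron_convex_cone_imp_polyhedral_cone)
  have SC: "S \<subseteq> C"
    unfolding S_def using K(2) closed_convex_coneD(2)[OF C] by (intro hull_minimal) auto
  have "S \<subseteq> angular_expansion C e"
  proof
    fix x assume x: "x \<in> S"
    have "dist_s x x = 0" by (simp add: dist_s_def power2_norm_eq_inner[symmetric] power2_eq_square)
    then show "x \<in> angular_expansion C e"
      using x SC e by (auto simp: angular_expansion_def intro!: bexI[of _ x])
  qed
  moreover have "C \<subseteq> angular_expansion S e"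
  proof
    fix x assume x: "x \<in> C"
    show "x \<in> angular_expansion S e"
    proof (cases "x = 0")
      case True
      then show ?thesis using convex_cone_contains_0[OF cone] e
        by (auto simp: angular_expansion_def dist_s_def intro!: bexI[of _ 0])
    next
      case False
      define u where "u = (1 / norm x) *\<^sub>R x"
      have "u \<in> C" unfolding u_def using C x by (intro closed_convex_cone_scaleR) auto
      moreover have nu: "norm u = 1" using False by (simp add: u_def)
      ultimately obtain y where y: "y \<in> K" "dist y u < \<delta>" using K(3) by auto
      have ny: "norm y = 1" using K(2) y(1) by auto
      have "(norm (y - u))\<^sup>2 < \<delta>\<^sup>2"
        using y(2) by (intro power_strict_mono) (auto simp: dist_norm)
      moreover have "(norm (y - u))\<^sup>2 = 2 - 2 * (u \<bullet> y)"
        using dot_norm_neg[of u y] nu ny by (simp add: norm_minus_commute)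
      ultimately have "cos e \<le> u \<bullet> y" using \<delta>(2) by simp
      moreover have "u \<bullet> y \<le> 1" using norm_cauchy_schwarz[of u y] nu ny by simp
      ultimately have "arccos (u \<bullet> y) \<le> arccos (cos e)"
        by (intro arccos_le_arccos) auto
      then have "arccos (u \<bullet> y) \<le> e" using e by (simp add: arccos_cos)
      moreover have "dist_s x y = arccos (u \<bullet> y)"
        using False ny by (auto simp: dist_s_def u_def)
      moreover have "y \<in> S" unfolding S_def using y(1) by (rule hull_inc)
      ultimately show ?thesis by (auto simp: angular_expansion_def intro!: bexI[of _ y])
    qed
  qed
  ultimately have "e \<in> {\<alpha>. \<alpha> \<ge> 0 \<and> C \<subseteq> angular_expansion S \<alpha> \<and> S \<subseteq> angular_expansion C \<alpha>}"
    using e by auto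
  then have "conic_hausdorff_dist S C \<le> e"
    unfolding conic_hausdorff_dist_def by (rule cInf_lower) (auto intro: bdd_belowI)
  with poly show thesis by (rule that)
qed

lemma conic_hausdorff_dist_nonneg:
  assumes "closed_convex_cone C" "closed_convex_cone D"
  shows "0 \<le> conic_hausdorff_dist C D"
  unfolding conic_hausdorff_dist_def
  by (rule cInf_greatest) (use conic_hausdorff_set_nonempty[OF assms] in auto)

lemma exists_polyhedral_sequence:
  assumes C: "closed_convex_cone C"
  obtains S where "\<And>i. polyhedral_cone (S i)" "(\<lambda>i. conic_hausdorff_dist (S i) C) \<longlonglongrightarrow> 0"
proof -
  have "\<exists>S. polyhedral_cone S \<and> conic_hausdorff_dist S C \<le> 1 / real (Suc i)" for i
  proof -
    have "1 / real (Suc i) \<le> 1" by simp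
    then have "1 / real (Suc i) \<le> pi" using pi_gt3 by linarith
    then show ?thesis using exists_polyhedral_approximation[OF C, of "1 / real (Suc i)"] by auto
  qed
  then obtain S where S: "\<And>i. polyhedral_cone (S i)" "\<And>i. conic_hausdorff_dist (S i) C \<le> 1 / real (Suc i)"
    by metis
  have "(\<lambda>i. conic_hausdorff_dist (S i) C) \<longlonglongrightarrow> 0"
  proof (rule tendsto_sandwich[of "\<lambda>_. 0" _ _ "\<lambda>i. 1 / real (Suc i)"])
    show "(\<lambda>i. 1 / real (Suc i)) \<longlonglongrightarrow> 0" using LIMSEQ_inverse_real_of_nat by (simp add: inverse_eq_divide)
    show "\<forall>\<^sub>F i in sequentially. 0 \<le> conic_hausdorff_dist (S i) C"
      using conic_hausdorff_dist_nonneg[OF polyhedral_cone_imp_closed_convex_cone[OF S(1)] C] by (simp add: eventually_sequentially)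
  qed (use S(2) in auto)
  with S(1) show thesis by (rule that)
qed

text \<open>Evaluating at \<open>2 * s\<close> and subtracting \<open>2 ^ Suc n\<close> times the value at \<open>s\<close> removes the
  leading coefficient.\<close>

lemma convergent_polynomial_coefficients:
  fixes c :: "nat \<Rightarrow> nat \<Rightarrow> real"
  assumes "\<And>s. 0 < s \<Longrightarrow> convergent (\<lambda>i. \<Sum>k\<le>n. c i k * s ^ k)" "k \<le> n"
  shows "convergent (\<lambda>i. c i k)"
  using assms
proof (induction n arbitrary: c k)
  case 0
  then show ?case using 0(1)[of 1] by simp
next
  case (Suc n)
  have low: "convergent (\<lambda>i. c i j)" if "j \<le> n" for j
  proof -
    define c' where "c' i k = c i k * (2 ^ k - 2 ^ Suc n)" for i k
    have "convergent (\<lambda>i. \<Sum>k\<le>n. c' i k * s ^ k)" if "0 < s" for s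
    proof -
      have "(\<Sum>k\<le>n. c' i k * s ^ k) = (\<Sum>k\<le>Suc n. c i k * (2 * s) ^ k) - 2 ^ Suc n * (\<Sum>k\<le>Suc n. c i k * s ^ k)" for i
        by (simp add: c'_def power_mult_distrib sum_distrib_left sum_subtractf[symmetric] algebra_simps)
      moreover have "convergent (\<lambda>i. (\<Sum>k\<le>Suc n. c i k * (2 * s) ^ k) - 2 ^ Suc n * (\<Sum>k\<le>Suc n. c i k * s ^ k))"
        using Suc.prems(1)[of s] Suc.prems(1)[of "2 * s"] that
        by (intro convergent_diff convergent_mult convergent_const) auto
      ultimately show ?thesis by simp
    qed
    then have "convergent (\<lambda>i. c' i j)" using Suc.IH[of c' j] that by simp
    then have "convergent (\<lambda>i. c' i j * (1 / (2 ^ j - 2 ^ Suc n)))"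
      by (intro convergent_mult convergent_const)
    moreover have "(2::real) ^ j < 2 ^ Suc n" using that by (intro power_strict_increasing) auto
    ultimately show ?thesis by (simp add: c'_def)
  qed
  show ?case
  proof (cases "k \<le> n")
    case False
    then have k: "k = Suc n" using Suc.prems(2) by simp
    have "convergent (\<lambda>i. (\<Sum>k\<le>Suc n. c i k * 1 ^ k) - (\<Sum>k\<le>n. c i k))"
      by (intro convergent_diff Suc.prems(1) convergent_sum low) auto
    then show ?thesis by (simp add: k)
  qed (rule low)
qed

lemma polynomial_coefficients_eq:
  fixes a b :: "nat \<Rightarrow> real"
  assumes "\<And>s. 0 < s \<Longrightarrow> (\<Sum>k\<le>n. a k * s ^ k) = (\<Sum>k\<le>n. b k * s ^ k)" "k \<le> n"
  shows "a k = b k"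
proof -
  have "{0<..} \<subseteq> {s. (\<Sum>k\<le>n. (a k - b k) * s ^ k) = 0}"
    using assms(1) by (auto simp: left_diff_distrib sum_subtractf)
  then have "infinite {s. (\<Sum>k\<le>n. (a k - b k) * s ^ k) = 0}"
    using infinite_Ioi infinite_super by blast
  then show ?thesis using assms(2) polyfun_finite_roots[of "\<lambda>k. a k - b k" n] by auto
qed

lemma polyhedral_intrinsic_volume_range:
  fixes C :: "(real^'d) set"
  shows "0 \<le> polyhedral_intrinsic_volume k C" "polyhedral_intrinsic_volume k C \<le> 1"
  using prob_space.prob_le_1[OF prob_space_std_gaussian] by (auto simp: polyhedral_intrinsic_volume_def)

text \<open>Convergence of the polynomials at every positive argument forces convergence of the
  coefficients. Their limits are again coefficients of a polynomial equal to
  \<open>proj_mgf C\<close>, so they do not depend on the sequence.\<close>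

lemma polyhedral_intrinsic_volume_limits:
  fixes C :: "(real^'d) set"
  assumes C: "closed_convex_cone C" and S: "\<And>i. polyhedral_cone (S i)"
    and lim: "(\<lambda>i. conic_hausdorff_dist (S i) C) \<longlonglongrightarrow> 0"
  obtains v where "\<And>k. k \<le> CARD('d) \<Longrightarrow> (\<lambda>i. polyhedral_intrinsic_volume k (S i)) \<longlonglongrightarrow> v k"
    "\<And>s. 0 < s \<Longrightarrow> proj_mgf C s = ennreal (\<Sum>k\<le>CARD('d). v k * s ^ k)"
    "\<And>k. k \<le> CARD('d) \<Longrightarrow> 0 \<le> v k"
proof
  define c where "c i k = polyhedral_intrinsic_volume k (S i)" for i k
  define v where "v k = lim (\<lambda>i. c i k)" for k
  have ccone: "closed_convex_cone (S i)" for i using S by (rule polyhedral_cone_imp_closed_convex_cone)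
  have P: "(\<lambda>i. ennreal (\<Sum>k\<le>CARD('d). c i k * s ^ k)) \<longlonglongrightarrow> proj_mgf C s" if "0 < s" for s
    using tendsto_proj_mgf[OF ccone C lim that] unfolding proj_mgf_polyhedral[OF S that] c_def .
  have nn: "0 \<le> (\<Sum>k\<le>CARD('d). c i k * s ^ k)" if "0 < s" for i s
    using that polyhedral_intrinsic_volume_range(1) by (intro sum_nonneg mult_nonneg_nonneg) (auto simp: c_def)
  have "convergent (\<lambda>i. \<Sum>k\<le>CARD('d). c i k * s ^ k)" if "0 < s" for s
  proof -
    \<comment> \<open>Coefficients are probabilities, so this bound is uniform in \<open>i\<close>;
      it makes the limit finite and lets convergence in \<open>ennreal\<close> be read as
      convergence of reals.\<close>
    have "(\<Sum>k\<le>CARD('d). c i k * s ^ k) \<le> (\<Sum>k\<le>CARD('d). 1 * s ^ k)" for i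
      using that polyhedral_intrinsic_volume_range(2) by (intro sum_mono mult_right_mono) (auto simp: c_def)
    then have "proj_mgf C s \<le> ennreal (\<Sum>k\<le>CARD('d). 1 * s ^ k)"
      by (intro LIMSEQ_le_const2[OF P[OF that]]) (auto intro!: exI[of _ 0] ennreal_leI)
    then have "proj_mgf C s = ennreal (enn2real (proj_mgf C s))"
      by (intro ennreal_enn2real[symmetric]) (auto simp: le_less_trans[OF _ ennreal_less_top])
    then have "(\<lambda>i. ennreal (\<Sum>k\<le>CARD('d). c i k * s ^ k)) \<longlonglongrightarrow> ennreal (enn2real (proj_mgf C s))"
      using P[OF that] by simp
    then show ?thesis
      using nn[OF that] by (subst (asm) tendsto_ennreal_iff) (auto intro: convergentI)
  qed
  then have "convergent (\<lambda>i. c i k)" if "k \<le> CARD('d)" for k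
    using that by (rule convergent_polynomial_coefficients)
  then have v: "(\<lambda>i. c i k) \<longlonglongrightarrow> v k" if "k \<le> CARD('d)" for k
    using that by (simp add: v_def convergent_LIMSEQ_iff)
  then show "(\<lambda>i. polyhedral_intrinsic_volume k (S i)) \<longlonglongrightarrow> v k" if "k \<le> CARD('d)" for k
    using that by (simp add: c_def)
  show "0 \<le> v k" if "k \<le> CARD('d)" for k
    by (rule LIMSEQ_le_const[OF v[OF that]]) (auto simp: c_def polyhedral_intrinsic_volume_range)
  show "proj_mgf C s = ennreal (\<Sum>k\<le>CARD('d). v k * s ^ k)" if "0 < s" for s
  proof (rule LIMSEQ_unique[OF P[OF that]])
    show "(\<lambda>i. ennreal (\<Sum>k\<le>CARD('d). c i k * s ^ k)) \<longlonglongrightarrow> ennreal (\<Sum>k\<le>CARD('d). v k * s ^ k)"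
      by (intro tendsto_ennrealI tendsto_sum tendsto_mult v tendsto_const) auto
  qed
qed

lemma ennreal_polynomial_coefficients_eq:
  fixes a b :: "nat \<Rightarrow> real"
  assumes "\<And>s. 0 < s \<Longrightarrow> ennreal (\<Sum>k\<le>n. a k * s ^ k) = ennreal (\<Sum>k\<le>n. b k * s ^ k)"
    and "\<And>k. k \<le> n \<Longrightarrow> 0 \<le> a k" "\<And>k. k \<le> n \<Longrightarrow> 0 \<le> b k" "k \<le> n"
  shows "a k = b k"
proof (rule polynomial_coefficients_eq[OF _ assms(4)])
  fix s :: real assume s: "0 < s"
  have "0 \<le> (\<Sum>k\<le>n. a k * s ^ k)" "0 \<le> (\<Sum>k\<le>n. b k * s ^ k)"
    using assms(2,3) s by (auto intro!: sum_nonneg mult_nonneg_nonneg)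
  then show "(\<Sum>k\<le>n. a k * s ^ k) = (\<Sum>k\<le>n. b k * s ^ k)" using assms(1)[OF s] by simp
qed

text \<open>For a cone that is not polyhedral the definite description has to be discharged. A limit
  common to all approximating sequences exists since \<open>proj_mgf C\<close> determines the
  coefficients; it is unique since there is at least one such sequence, without which any number
  would qualify vacuously.\<close>

theorem proj_mgf_eq:
  fixes C :: "(real^'d) set"
  assumes C: "closed_convex_cone C"
  shows "k \<le> CARD('d) \<Longrightarrow> 0 \<le> conic_intrinsic_volume k C"
    and "0 < s \<Longrightarrow> proj_mgf C s = ennreal (\<Sum>k\<le>CARD('d). conic_intrinsic_volume k C * s ^ k)"
proof -
  have "(\<forall>k\<le>CARD('d). 0 \<le> conic_intrinsic_volume k C) \<and>
    (\<forall>s>0. proj_mgf C s = ennreal (\<Sum>k\<le>CARD('d). conic_intrinsic_volume k C * s ^ k))"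
  proof (cases "polyhedral_cone C")
    case True
    then show ?thesis
      using proj_mgf_polyhedral[OF True] by (simp add: conic_intrinsic_volume_def polyhedral_intrinsic_volume_range)
  next
    case False
    obtain S where S: "\<And>i. polyhedral_cone (S i)" "(\<lambda>i. conic_hausdorff_dist (S i) C) \<longlonglongrightarrow> 0"
      using exists_polyhedral_sequence[OF C] by blast
    obtain v where v: "\<And>k. k \<le> CARD('d) \<Longrightarrow> (\<lambda>i. polyhedral_intrinsic_volume k (S i)) \<longlonglongrightarrow> v k"
      "\<And>s. 0 < s \<Longrightarrow> proj_mgf C s = ennreal (\<Sum>k\<le>CARD('d). v k * s ^ k)"
      "\<And>k. k \<le> CARD('d) \<Longrightarrow> 0 \<le> v k"
      using polyhedral_intrinsic_volume_limits[OF C S] by blast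
    have "conic_intrinsic_volume k C = v k" if k: "k \<le> CARD('d)" for k
    proof -
      have all: "(\<lambda>i. polyhedral_intrinsic_volume k (S' i)) \<longlonglongrightarrow> v k"
        if S': "\<And>i. polyhedral_cone (S' i)" "(\<lambda>i. conic_hausdorff_dist (S' i) C) \<longlonglongrightarrow> 0" for S'
      proof -
        obtain v' where v': "\<And>k. k \<le> CARD('d) \<Longrightarrow> (\<lambda>i. polyhedral_intrinsic_volume k (S' i)) \<longlonglongrightarrow> v' k"
          "\<And>s. 0 < s \<Longrightarrow> proj_mgf C s = ennreal (\<Sum>k\<le>CARD('d). v' k * s ^ k)"
          "\<And>k. k \<le> CARD('d) \<Longrightarrow> 0 \<le> v' k"
          using polyhedral_intrinsic_volume_limits[OF C S'] by blast
        have "v' k = v k"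
          using v(2) v'(2) by (intro ennreal_polynomial_coefficients_eq[OF _ v'(3) v(3) k]) auto
        then show ?thesis using v'(1)[OF k] by simp
      qed
      show ?thesis
        unfolding conic_intrinsic_volume_def using False
      proof (simp, intro the_equality)
        fix w assume "\<forall>S. (\<forall>i. polyhedral_cone (S i)) \<and> (\<lambda>i. conic_hausdorff_dist (S i) C) \<longlonglongrightarrow> 0 \<longrightarrow>
          (\<lambda>i. polyhedral_intrinsic_volume k (S i)) \<longlonglongrightarrow> w"
        then have "(\<lambda>i. polyhedral_intrinsic_volume k (S i)) \<longlonglongrightarrow> w" using S by blast
        then show "w = v k" using all[OF S] by (rule LIMSEQ_unique)
      qed (use all in blast)
    qed
    then show ?thesis using v(2,3) by simp
  qed
  then show "k \<le> CARD('d) \<Longrightarrow> 0 \<le> conic_intrinsic_volume k C"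
    "0 < s \<Longrightarrow> proj_mgf C s = ennreal (\<Sum>k\<le>CARD('d). conic_intrinsic_volume k C * s ^ k)" by blast+
qed

section \<open>The Prekopa--Leindler inequality\<close>

lemma emeasure_lborel_Int_atMost:
  fixes A :: "real set"
  assumes [measurable]: "A \<in> sets borel" and "A \<noteq> {}" "bdd_above A" and e: "e > 0"
  obtains a where "a \<in> A" "emeasure lborel A \<le> emeasure lborel (A \<inter> {..a}) + ennreal e"
proof -
  obtain a where a: "a \<in> A" "Sup A - e < a"
    using less_cSup_iff[OF assms(2,3), of "Sup A - e"] e by auto
  have "A \<subseteq> (A \<inter> {..a}) \<union> {a..a + e}"
    using a(2) cSup_upper[OF _ assms(3)] by force
  then have "emeasure lborel A \<le> emeasure lborel ((A \<inter> {..a}) \<union> {a..a + e})"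
    by (intro emeasure_mono) auto
  also have "\<dots> \<le> emeasure lborel (A \<inter> {..a}) + emeasure lborel {a..a + e}"
    by (intro emeasure_subadditive) auto
  finally show ?thesis using e by (intro that[OF a(1)]) simp
qed

lemma emeasure_lborel_preimage_affine:
  fixes A :: "real set"
  assumes [measurable]: "A \<in> sets borel" and "c \<noteq> 0"
  shows "emeasure lborel {x. (x - t) / c \<in> A} = ennreal \<bar>c\<bar> * emeasure lborel A"
proof -
  have "emeasure lborel {x. (x - t) / c \<in> A} = (\<integral>\<^sup>+x. indicator {x. (x - t) / c \<in> A} x \<partial>lborel)"
    by simp
  also have "\<dots> = (\<integral>\<^sup>+x. indicator A ((x - t) / c) \<partial>lborel)"
    by (intro nn_integral_cong) (simp add: indicator_def)
  also have "\<dots> = ennreal \<bar>c\<bar> * (\<integral>\<^sup>+x. indicator A x \<partial>lborel)"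
    using assms by (subst nn_integral_real_affine[of _ c t]) auto
  finally show ?thesis by simp
qed

text \<open>Take \<open>a\<close> close to the supremum of \<open>A\<close> and \<open>b\<close>
  close to the infimum of \<open>B\<close>. The part of \<open>A\<close> below \<open>a\<close>,
  shifted by \<open>b\<close>, and the part of \<open>B\<close> above \<open>b\<close>, shifted by
  \<open>a\<close>, both lie in \<open>M\<close> and meet at most in \<open>a + b\<close>; the parts
  cut off have measure at most \<open>e / 2\<close> each. \<open>M\<close> is a measurable superset,
  as a sumset of Borel sets need not be Borel.\<close>

lemma emeasure_lborel_sumset_bounded:
  fixes A B M :: "real set"
  assumes [measurable]: "A \<in> sets borel" "B \<in> sets borel" "M \<in> sets borel"
    and ne: "A \<noteq> {}" "B \<noteq> {}" and bdd: "bdd_above A" "bdd_below B"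
    and sum: "\<And>x y. x \<in> A \<Longrightarrow> y \<in> B \<Longrightarrow> x + y \<in> M"
  shows "emeasure lborel A + emeasure lborel B \<le> emeasure lborel M"
proof (rule ennreal_le_epsilon)
  fix e :: real assume e: "0 < e"
  obtain a where a: "a \<in> A" "emeasure lborel A \<le> emeasure lborel (A \<inter> {..a}) + ennreal (e/2)"
    using emeasure_lborel_Int_atMost[of A "e/2"] ne bdd e by auto
  have refl: "emeasure lborel {x. - x \<in> S} = emeasure lborel S" if "S \<in> sets borel" for S :: "real set"
    using emeasure_lborel_preimage_affine[OF that, of "-1" 0] by simp
  have [measurable]: "{x. - x \<in> B} \<in> sets borel"
    by measurable
  have "bdd_above {x. - x \<in> B}"
    using bdd(2) unfolding bdd_above_def bdd_below_def by (auto intro: le_minus_iff[THEN iffD1])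
  moreover have "{x. - x \<in> B} \<noteq> {}"
    using ne(2) by (metis Collect_empty_eq ex_in_conv minus_minus)
  ultimately obtain b' where b': "- b' \<in> B"
    "emeasure lborel {x. - x \<in> B} \<le> emeasure lborel ({x. - x \<in> B} \<inter> {..b'}) + ennreal (e/2)"
    using emeasure_lborel_Int_atMost[of "{x. - x \<in> B}" "e/2"] e by auto
  define b where "b = - b'"
  have "{x. - x \<in> B} \<inter> {..b'} = {x. - x \<in> B \<inter> {b..}}" by (auto simp: b_def)
  then have "emeasure lborel ({x. - x \<in> B} \<inter> {..b'}) = emeasure lborel (B \<inter> {b..})"
    using refl[of "B \<inter> {b..}"] by simp
  with b' have b: "b \<in> B" "emeasure lborel B \<le> emeasure lborel (B \<inter> {b..}) + ennreal (e/2)"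
    by (simp_all add: b_def refl)
  define A' where "A' = {x. (x - b) / 1 \<in> A \<inter> {..a}}"
  define B' where "B' = {x. (x - a) / 1 \<in> B \<inter> {b..}}"
  have [measurable]: "A' \<in> sets borel" "B' \<in> sets borel"
    unfolding A'_def B'_def by measurable
  have "A' \<inter> B' \<subseteq> {a + b}" by (auto simp: A'_def B'_def)
  then have "emeasure lborel (A' \<inter> B') \<le> emeasure lborel {a + b}"
    by (intro emeasure_mono) auto
  then have null: "A' \<inter> B' \<in> null_sets lborel" by (auto simp: null_sets_def)
  have "emeasure lborel A + emeasure lborel B \<le>
      (emeasure lborel (A \<inter> {..a}) + ennreal (e/2)) + (emeasure lborel (B \<inter> {b..}) + ennreal (e/2))"
    using a b by (intro add_mono) auto
  also have "\<dots> = emeasure lborel (A \<inter> {..a}) + emeasure lborel (B \<inter> {b..}) + (ennreal (e/2) + ennreal (e/2))"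
    by (simp add: add_ac)
  also have "ennreal (e/2) + ennreal (e/2) = ennreal e"
    using e by (simp flip: ennreal_plus)
  also have "emeasure lborel (A \<inter> {..a}) + emeasure lborel (B \<inter> {b..}) = emeasure lborel A' + emeasure lborel B'"
    unfolding A'_def B'_def by (subst (1 2) emeasure_lborel_preimage_affine) auto
  also have "emeasure lborel A' + emeasure lborel B' = emeasure lborel (A' \<union> B')"
    by (rule emeasure_Un'[symmetric]) (use null in auto)
  also have "emeasure lborel (A' \<union> B') \<le> emeasure lborel M"
  proof (rule emeasure_mono)
    show "A' \<union> B' \<subseteq> M"
      using sum[of _ b] sum[OF a(1)] b(1) by (force simp: A'_def B'_def)
  qed simp
  finally show "emeasure lborel A + emeasure lborel B \<le> emeasure lborel M + ennreal e"
    by (simp add: add_right_mono)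
qed

text \<open>Exhaustion by the intervals from \<open>- n\<close> to \<open>n\<close>; from some
  \<open>n\<close> on both truncated sets contain a fixed point and so are nonempty.\<close>

lemma emeasure_lborel_sumset:
  fixes A B M :: "real set"
  assumes [measurable]: "A \<in> sets borel" "B \<in> sets borel" "M \<in> sets borel"
    and ne: "A \<noteq> {}" "B \<noteq> {}"
    and sum: "\<And>x y. x \<in> A \<Longrightarrow> y \<in> B \<Longrightarrow> x + y \<in> M"
  shows "emeasure lborel A + emeasure lborel B \<le> emeasure lborel M"
proof (rule LIMSEQ_le_const2)
  have lim: "(\<lambda>n. emeasure lborel (S \<inter> {- real n..real n})) \<longlonglongrightarrow> emeasure lborel S"
    if [measurable]: "S \<in> sets borel" for S :: "real set"
  proof -
    have "(\<Union>n. S \<inter> {- real n..real n}) = S"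
    proof safe
      fix x assume "x \<in> S"
      obtain n where "\<bar>x\<bar> \<le> real n" using real_arch_simple by blast
      with \<open>x \<in> S\<close> show "x \<in> (\<Union>n. S \<inter> {- real n..real n})" by (auto intro!: exI[of _ n])
    qed
    moreover have "incseq (\<lambda>n. S \<inter> {- real n..real n})"
      by (force simp: incseq_def)
    ultimately show ?thesis
      using Lim_emeasure_incseq[of "\<lambda>n. S \<inter> {- real n..real n}" lborel] by (auto simp: image_subset_iff)
  qed
  show "(\<lambda>n. emeasure lborel (A \<inter> {- real n..real n}) + emeasure lborel (B \<inter> {- real n..real n}))
      \<longlonglongrightarrow> emeasure lborel A + emeasure lborel B"
    by (intro tendsto_add lim) simp_all
  obtain a b where ab: "a \<in> A" "b \<in> B" using ne by auto
  obtain N where N: "\<bar>a\<bar> + \<bar>b\<bar> \<le> real N" using real_arch_simple by blast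
  have "emeasure lborel (A \<inter> {- real n..real n}) + emeasure lborel (B \<inter> {- real n..real n})
      \<le> emeasure lborel M" if "n \<ge> N" for n
  proof (rule emeasure_lborel_sumset_bounded)
    have "a \<in> A \<inter> {- real n..real n}" "b \<in> B \<inter> {- real n..real n}" using ab N that by auto
    then show "A \<inter> {- real n..real n} \<noteq> {}" "B \<inter> {- real n..real n} \<noteq> {}" by blast+
  qed (use sum in auto)
  then show "\<exists>N. \<forall>n\<ge>N. emeasure lborel (A \<inter> {- real n..real n}) +
      emeasure lborel (B \<inter> {- real n..real n}) \<le> emeasure lborel M" by blast
qed

text \<open>The layer-cake formula at one point, with levels written as fractions \<open>t\<close>
  of \<open>U\<close>. Strict levels, used for the two given functions, recover the truncation
  exactly; non-strict levels, used for the majorant, need only an upper bound.\<close>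

lemma emeasure_level_line:
  assumes U: "0 < (U::real)"
  shows "ennreal U * emeasure lborel {t. 0 < t \<and> t < 1 \<and> ennreal (t * U) < p} = min p (ennreal U)"
    and "ennreal U * emeasure lborel {t. 0 < t \<and> t < 1 \<and> ennreal (t * U) \<le> p} \<le> p"
proof -
  show "ennreal U * emeasure lborel {t. 0 < t \<and> t < 1 \<and> ennreal (t * U) < p} = min p (ennreal U)"
  proof (cases p)
    case (real r)
    have "{t. 0 < t \<and> t < 1 \<and> ennreal (t * U) < p} = {0<..<min 1 (r / U)}"
      using real U by (auto simp: ennreal_less_iff field_simps)
    moreover have "U * min 1 (r / U) = min r U" using U real by (auto simp: min_def field_simps)
    ultimately show ?thesis
      using U real by (cases "r \<le> U") (auto simp: min_def ennreal_le_iff simp flip: ennreal_mult')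
  next
    case top
    then have "{t. 0 < t \<and> t < 1 \<and> ennreal (t * U) < p} = {0<..<1}" by auto
    then show ?thesis using top by (simp add: min_def top_unique)
  qed
  show "ennreal U * emeasure lborel {t. 0 < t \<and> t < 1 \<and> ennreal (t * U) \<le> p} \<le> p"
  proof (cases p)
    case (real r)
    have "{t. 0 < t \<and> t < 1 \<and> ennreal (t * U) \<le> p} \<subseteq> {0..r / U}"
      using real U by (auto simp: ennreal_le_iff field_simps)
    then have "emeasure lborel {t. 0 < t \<and> t < 1 \<and> ennreal (t * U) \<le> p} \<le> emeasure lborel {0..r/U}"
      by (intro emeasure_mono) auto
    also have "\<dots> = ennreal (r / U)" using U real by simp
    finally have "ennreal U * emeasure lborel {t. 0 < t \<and> t < 1 \<and> ennreal (t * U) \<le> p} \<le> ennreal U * ennreal (r / U)"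
      by (intro mult_left_mono) auto
    also have "\<dots> = p" using U real by (simp flip: ennreal_mult')
    finally show ?thesis .
  qed simp
qed

lemma nn_integral_level:
  fixes P :: "'a::euclidean_space \<Rightarrow> real \<Rightarrow> bool"
  assumes [measurable]: "Measurable.pred (borel \<Otimes>\<^sub>M borel) (case_prod P)"
  shows "(\<integral>\<^sup>+t. emeasure lborel {x. P x t} * indicator {0<..<1} t \<partial>lborel) =
    (\<integral>\<^sup>+x. emeasure lborel {t. 0 < t \<and> t < 1 \<and> P x t} \<partial>lborel)"
proof -
  have "(\<integral>\<^sup>+t. emeasure lborel {x. P x t} * indicator {0<..<1} t \<partial>lborel) =
      (\<integral>\<^sup>+t. (\<integral>\<^sup>+x. indicator {x. P x t} x * indicator {0<..<1} t \<partial>lborel) \<partial>lborel)"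
    by (intro nn_integral_cong) (simp add: nn_integral_multc)
  also have "\<dots> = (\<integral>\<^sup>+x. (\<integral>\<^sup>+t. indicator {x. P x t} x * indicator {0<..<1} t \<partial>lborel) \<partial>lborel)"
    by (rule lborel_pair.Fubini') (simp add: indicator_def)
  also have "\<dots> = (\<integral>\<^sup>+x. (\<integral>\<^sup>+t. indicator {t. 0 < t \<and> t < 1 \<and> P x t} t \<partial>lborel) \<partial>lborel)"
    by (intro nn_integral_cong) (auto simp: indicator_def)
  finally show ?thesis by simp
qed

text \<open>Says that the weighted geometric mean of \<open>p\<close> and \<open>q\<close> is at most \<open>r\<close>. Quantifying over finite positive
  minorants avoids powers of extended reals and the product of zero and infinity.\<close>

definition geo_mean_le :: "real \<Rightarrow> ennreal \<Rightarrow> ennreal \<Rightarrow> ennreal \<Rightarrow> bool" where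
  "geo_mean_le l p q r \<longleftrightarrow> (\<forall>a>0. \<forall>b>0. ennreal a < p \<longrightarrow> ennreal b < q \<longrightarrow>
     ennreal (a powr (1 - l) * b powr l) \<le> r)"

text \<open>The sumset inequality requires nonempty level sets. Truncating far out keeps the
  integral above \<open>a\<close>, and choosing \<open>U\<close> as the supremum of the truncated
  function makes all levels \<open>t * U\<close> with \<open>0 < t < 1\<close> be exceeded
  somewhere.\<close>

lemma exists_truncation:
  fixes u :: "'a \<Rightarrow> ennreal"
  assumes [measurable]: "u \<in> borel_measurable M" and a: "ennreal a < (\<integral>\<^sup>+x. u x \<partial>M)"
    and M: "space M \<noteq> {}"
  obtains U where "0 < U" "ennreal a < (\<integral>\<^sup>+x. min (u x) (ennreal U) \<partial>M)"
    "\<And>t. 0 < t \<Longrightarrow> t < 1 \<Longrightarrow> \<exists>x\<in>space M. ennreal (t * U) < u x"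
proof -
  have "(SUP n. min (u x) (of_nat n)) = u x" for x
  proof -
    have "(SUP n. min (u x) (of_nat n)) = min (u x) (SUP n. of_nat n)"
      unfolding inf_min[symmetric] by (rule inf_SUP[symmetric])
    then show ?thesis by (simp add: ennreal_SUP_of_nat_eq_top min_def)
  qed
  then have "(\<integral>\<^sup>+x. u x \<partial>M) = (\<integral>\<^sup>+x. (SUP n. min (u x) (of_nat n)) \<partial>M)" by simp
  also have "\<dots> = (SUP n. \<integral>\<^sup>+x. min (u x) (of_nat n) \<partial>M)"
    by (rule nn_integral_monotone_convergence_SUP)
      (auto simp: incseq_def le_fun_def intro: min.coboundedI2)
  finally obtain n :: nat where n: "ennreal a < (\<integral>\<^sup>+x. min (u x) (of_nat n) \<partial>M)"
    using a by (auto simp: less_SUP_iff)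
  define S where "S = (SUP x\<in>space M. min (u x) (of_nat n))"
  have "S \<le> of_nat n" unfolding S_def by (intro SUP_least) auto
  then have fin: "S < top" by (rule le_less_trans) (simp add: of_nat_less_top)
  define U where "U = enn2real S"
  have S: "ennreal U = S" using fin by (simp add: U_def)
  have le: "min (u x) (of_nat n) \<le> min (u x) S" if "x \<in> space M" for x
    using that by (auto simp: S_def intro: SUP_upper)
  show thesis
  proof
    have "(\<integral>\<^sup>+x. min (u x) (of_nat n) \<partial>M) \<le> (\<integral>\<^sup>+x. min (u x) S \<partial>M)"
      using le by (intro nn_integral_mono)
    with n show *: "ennreal a < (\<integral>\<^sup>+x. min (u x) (ennreal U) \<partial>M)" unfolding S by simp
    show U: "0 < U"
    proof (rule ccontr)
      assume "\<not> 0 < U"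
      then have "ennreal U = 0" by (simp add: ennreal_eq_0_iff)
      with * show False by simp
    qed
    fix t :: real assume t: "0 < t" "t < 1"
    have "ennreal (t * U) < S" using U t by (simp add: ennreal_less_iff flip: S)
    then show "\<exists>x\<in>space M. ennreal (t * U) < u x"
      by (auto simp: S_def less_SUP_iff)
  qed
qed

text \<open>Rescaling both functions to supremum 1 makes their level sets at a common fraction
  \<open>t\<close> nonempty together, so Brunn-Minkowski applies at every \<open>t\<close>.
  Integration over \<open>t\<close> yields an arithmetic mean inequality, stronger than the
  geometric one that is claimed.\<close>

proposition Prekopa_Leindler_real:
  fixes u v h :: "real \<Rightarrow> ennreal"
  assumes l: "0 < l" "l < 1"
    and [measurable]: "u \<in> borel_measurable borel" "v \<in> borel_measurable borel" "h \<in> borel_measurable borel"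
    and le: "\<And>x y. geo_mean_le l (u x) (v y) (h ((1 - l) * x + l * y))"
  shows "geo_mean_le l (\<integral>\<^sup>+x. u x \<partial>lborel) (\<integral>\<^sup>+x. v x \<partial>lborel) (\<integral>\<^sup>+x. h x \<partial>lborel)"
  unfolding geo_mean_le_def
proof safe
  fix a b :: real
  assume ab: "0 < a" "0 < b" and a: "ennreal a < (\<integral>\<^sup>+x. u x \<partial>lborel)" and b: "ennreal b < (\<integral>\<^sup>+x. v x \<partial>lborel)"
  obtain U where U: "0 < U" "ennreal a < (\<integral>\<^sup>+x. min (u x) (ennreal U) \<partial>lborel)"
    "\<And>t. 0 < t \<Longrightarrow> t < 1 \<Longrightarrow> \<exists>x. ennreal (t * U) < u x"
    using exists_truncation[OF _ a] by auto
  obtain V where V: "0 < V" "ennreal b < (\<integral>\<^sup>+x. min (v x) (ennreal V) \<partial>lborel)"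
    "\<And>t. 0 < t \<Longrightarrow> t < 1 \<Longrightarrow> \<exists>x. ennreal (t * V) < v x"
    using exists_truncation[OF _ b] by auto
  define W where "W = U powr (1 - l) * V powr l"
  have W: "W > 0" using U V by (simp add: W_def)
  define A where "A t = emeasure lborel {x. ennreal (t * U) < u x}" for t
  define B where "B t = emeasure lborel {x. ennreal (t * V) < v x}" for t
  define H where "H t = emeasure lborel {x. ennreal (t * W) \<le> h x}" for t
  have [measurable]: "A \<in> borel_measurable borel" "B \<in> borel_measurable borel" "H \<in> borel_measurable borel"
    unfolding A_def B_def H_def by measurable
  have level: "ennreal (1 - l) * A t + ennreal l * B t \<le> H t" if t: "0 < t" "t < 1" for t
  proof -
    have "emeasure lborel {x. (x - 0) / (1 - l) \<in> {x. ennreal (t * U) < u x}} +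
        emeasure lborel {x. (x - 0) / l \<in> {x. ennreal (t * V) < v x}} \<le>
        emeasure lborel {x. ennreal (t * W) \<le> h x}"
    proof (rule emeasure_lborel_sumset)
      obtain x y where "ennreal (t * U) < u x" "ennreal (t * V) < v y" using U(3) V(3) t by blast
      then have "(1 - l) * x \<in> {x. (x - 0) / (1 - l) \<in> {x. ennreal (t * U) < u x}}"
        "l * y \<in> {x. (x - 0) / l \<in> {x. ennreal (t * V) < v x}}" using l by auto
      then show "{x. (x - 0) / (1 - l) \<in> {x. ennreal (t * U) < u x}} \<noteq> {}"
        "{x. (x - 0) / l \<in> {x. ennreal (t * V) < v x}} \<noteq> {}" by blast+
      fix x y assume x: "x \<in> {x. (x - 0) / (1 - l) \<in> {x. ennreal (t * U) < u x}}"
        and y: "y \<in> {x. (x - 0) / l \<in> {x. ennreal (t * V) < v x}}"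
      have "ennreal ((t * U) powr (1 - l) * (t * V) powr l) \<le> h ((1 - l) * (x / (1 - l)) + l * (y / l))"
        using le[of "x / (1 - l)" "y / l"] x y t U(1) V(1) unfolding geo_mean_le_def by auto
      \<comment> \<open>The weights add up to 1, so the common fraction \<open>t\<close> comes out
        to the first power.\<close>
      moreover have "(t * U) powr (1 - l) * (t * V) powr l = t * W"
      proof -
        have "(t * U) powr (1 - l) * (t * V) powr l = (t powr (1 - l) * t powr l) * W"
          using t U V by (simp add: W_def powr_mult)
        also have "t powr (1 - l) * t powr l = t" using t by (simp flip: powr_add)
        finally show ?thesis .
      qed
      ultimately show "x + y \<in> {x. ennreal (t * W) \<le> h x}" using l by simp
    qed measurable
    then show ?thesis
      using l by (subst (asm) (1 2) emeasure_lborel_preimage_affine) (auto simp: A_def B_def H_def)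
  qed
  let ?I = "\<lambda>f. \<integral>\<^sup>+t. f t * indicator {0<..<1} t \<partial>lborel"
  have IA: "ennreal U * ?I A = (\<integral>\<^sup>+x. min (u x) (ennreal U) \<partial>lborel)"
    unfolding A_def using emeasure_level_line(1)[OF U(1)]
    by (subst nn_integral_level) (simp_all flip: nn_integral_cmult)
  have IB: "ennreal V * ?I B = (\<integral>\<^sup>+x. min (v x) (ennreal V) \<partial>lborel)"
    unfolding B_def using emeasure_level_line(1)[OF V(1)]
    by (subst nn_integral_level) (simp_all flip: nn_integral_cmult)
  have IH: "ennreal W * ?I H \<le> (\<integral>\<^sup>+x. h x \<partial>lborel)"
    unfolding H_def using emeasure_level_line(2)[OF W]
    by (subst nn_integral_level) (auto simp flip: nn_integral_cmult intro!: nn_integral_mono)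
  have cancel: "ennreal (c / X) \<le> Y" if "ennreal c < ennreal X * Y" "X > 0" "c > 0" for c X Y
  proof (cases Y)
    case (real r)
    then have "c < X * r" using that by (simp add: ennreal_less_iff flip: ennreal_mult')
    then show ?thesis using real that by (simp add: ennreal_le_iff field_simps)
  qed simp
  have A1: "ennreal (a / U) \<le> ?I A" using U ab IA by (intro cancel) auto
  have B1: "ennreal (b / V) \<le> ?I B" using V ab IB by (intro cancel) auto
  have "a powr (1 - l) * b powr l = W * ((a / U) powr (1 - l) * (b / V) powr l)"
    using U V ab by (simp add: W_def powr_divide)
  also have "\<dots> \<le> W * ((1 - l) * (a / U) + l * (b / V))"
    using W U V ab l by (intro mult_left_mono Youngs_inequality_0) auto
  finally have "ennreal (a powr (1 - l) * b powr l) \<le> ennreal (W * ((1 - l) * (a / U) + l * (b / V)))"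
    by (rule ennreal_leI)
  also have "\<dots> = ennreal W * (ennreal (1 - l) * ennreal (a / U) + ennreal l * ennreal (b / V))"
    using W U V ab l by (simp del: times_divide_eq_right flip: ennreal_mult' ennreal_plus)
  also have "\<dots> \<le> ennreal W * (ennreal (1 - l) * ?I A + ennreal l * ?I B)"
    by (intro mult_left_mono add_mono A1 B1) auto
  also have "ennreal (1 - l) * ?I A + ennreal l * ?I B =
      ?I (\<lambda>t. ennreal (1 - l) * A t + ennreal l * B t)"
    by (simp add: nn_integral_add distrib_right mult.assoc nn_integral_cmult)
  also have "\<dots> \<le> ?I H"
    using level by (intro nn_integral_mono) (auto simp: indicator_def)
  finally show "ennreal (a powr (1 - l) * b powr l) \<le> (\<integral>\<^sup>+x. h x \<partial>lborel)"
    using IH by (meson mult_left_mono order_trans zero_le)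
qed

text \<open>Tensorization: with the other coordinates frozen, the one-dimensional inequality shows
  that the functions integrated over the new coordinate satisfy the hypothesis again. That
  hypothesis concerns extensional functions, which are the points of the product space.\<close>

proposition Prekopa_Leindler_PiM:
  fixes u v h :: "('i \<Rightarrow> real) \<Rightarrow> ennreal"
  assumes l: "0 < l" "l < 1" and "finite I"
    and "u \<in> borel_measurable (Pi\<^sub>M I (\<lambda>_. lborel))" "v \<in> borel_measurable (Pi\<^sub>M I (\<lambda>_. lborel))"
      "h \<in> borel_measurable (Pi\<^sub>M I (\<lambda>_. lborel))"
    and "\<And>x y. x \<in> extensional I \<Longrightarrow> y \<in> extensional I \<Longrightarrow>
      geo_mean_le l (u x) (v y) (h (\<lambda>i\<in>I. (1 - l) * x i + l * y i))"
  shows "geo_mean_le l (\<integral>\<^sup>+x. u x \<partial>Pi\<^sub>M I (\<lambda>_. lborel)) (\<integral>\<^sup>+x. v x \<partial>Pi\<^sub>M I (\<lambda>_. lborel))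
    (\<integral>\<^sup>+x. h x \<partial>Pi\<^sub>M I (\<lambda>_. lborel))"
  using assms(3-)
proof (induction I arbitrary: u v h rule: finite_induct)
  case empty
  then show ?case by (simp add: PiM_empty nn_integral_count_space_finite restrict_def)
next
  case (insert i I)
  interpret product_sigma_finite "\<lambda>_::'i. lborel :: real measure" ..
  note [measurable] = insert.prems(1-3)
  have "geo_mean_le l (\<integral>\<^sup>+t. u (x(i := t)) \<partial>lborel) (\<integral>\<^sup>+t. v (y(i := t)) \<partial>lborel)
      (\<integral>\<^sup>+t. h ((\<lambda>j\<in>I. (1 - l) * x j + l * y j)(i := t)) \<partial>lborel)"
    if x: "x \<in> extensional I" and y: "y \<in> extensional I" for x y
  proof (rule Prekopa_Leindler_real[OF l])
    have [measurable]: "(\<lambda>t. z(i := t)) \<in> measurable borel (Pi\<^sub>M (insert i I) (\<lambda>_. lborel :: real measure))"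
      if "z \<in> extensional I" for z
      using that by (intro measurable_fun_upd[where J=I]) (auto simp: space_PiM PiE_def)
    show "(\<lambda>t. u (x(i := t))) \<in> borel_measurable borel" "(\<lambda>t. v (y(i := t))) \<in> borel_measurable borel"
      using x y by measurable
    show "(\<lambda>t. h ((\<lambda>j\<in>I. (1 - l) * x j + l * y j)(i := t))) \<in> borel_measurable borel"
      by measurable
    fix s t
    have "x(i := s) \<in> extensional (insert i I)" "y(i := t) \<in> extensional (insert i I)"
      using x y by (auto simp: extensional_def)
    note insert.prems(4)[OF this]
    moreover have "(\<lambda>j\<in>insert i I. (1 - l) * (x(i := s)) j + l * (y(i := t)) j) =
        (\<lambda>j\<in>I. (1 - l) * x j + l * y j)(i := (1 - l) * s + l * t)"
      using insert.hyps by (auto simp: fun_eq_iff restrict_def)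
    ultimately show "geo_mean_le l (u (x(i := s))) (v (y(i := t)))
        (h ((\<lambda>j\<in>I. (1 - l) * x j + l * y j)(i := (1 - l) * s + l * t)))"
      by (simp only:)
  qed
  moreover have meas: "(\<lambda>x. \<integral>\<^sup>+t. w (x(i := t)) \<partial>lborel) \<in> borel_measurable (Pi\<^sub>M I (\<lambda>_. lborel))"
    if [measurable]: "w \<in> borel_measurable (Pi\<^sub>M (insert i I) (\<lambda>_. lborel))" for w :: "('i \<Rightarrow> real) \<Rightarrow> ennreal"
    by measurable
  ultimately have "geo_mean_le l (\<integral>\<^sup>+x. (\<integral>\<^sup>+t. u (x(i := t)) \<partial>lborel) \<partial>Pi\<^sub>M I (\<lambda>_. lborel))
      (\<integral>\<^sup>+x. (\<integral>\<^sup>+t. v (x(i := t)) \<partial>lborel) \<partial>Pi\<^sub>M I (\<lambda>_. lborel))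
      (\<integral>\<^sup>+x. (\<integral>\<^sup>+t. h (x(i := t)) \<partial>lborel) \<partial>Pi\<^sub>M I (\<lambda>_. lborel))"
    by (intro insert.IH meas insert.prems(1-3))
  then show ?case
    using insert.hyps by (simp add: product_nn_integral_insert)
qed

theorem Prekopa_Leindler:
  fixes u v h :: "'a::euclidean_space \<Rightarrow> ennreal"
  assumes l: "0 < l" "l < 1"
    and [measurable]: "u \<in> borel_measurable borel" "v \<in> borel_measurable borel" "h \<in> borel_measurable borel"
    and le: "\<And>x y. geo_mean_le l (u x) (v y) (h ((1 - l) *\<^sub>R x + l *\<^sub>R y))"
  shows "geo_mean_le l (\<integral>\<^sup>+x. u x \<partial>lborel) (\<integral>\<^sup>+x. v x \<partial>lborel) (\<integral>\<^sup>+x. h x \<partial>lborel)"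
proof -
  define T :: "('a \<Rightarrow> real) \<Rightarrow> 'a" where "T = (\<lambda>f. \<Sum>b\<in>Basis. f b *\<^sub>R b)"
  have [measurable]: "T \<in> measurable (Pi\<^sub>M Basis (\<lambda>_. lborel)) borel"
    unfolding T_def by measurable
  have eq: "(\<integral>\<^sup>+x. f x \<partial>lborel) = (\<integral>\<^sup>+x. f (T x) \<partial>Pi\<^sub>M Basis (\<lambda>_. lborel))"
    if [measurable]: "f \<in> borel_measurable borel" for f :: "'a \<Rightarrow> ennreal"
    by (subst lborel_eq, fold T_def) (simp add: nn_integral_distr)
  have T: "T (\<lambda>i\<in>Basis. (1 - l) * x i + l * y i) = (1 - l) *\<^sub>R T x + l *\<^sub>R T y" for x y
    by (simp add: T_def scaleR_sum_right scaleR_add_left sum.distrib)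
  show ?thesis
    unfolding eq[OF assms(3)] eq[OF assms(4)] eq[OF assms(5)]
    by (rule Prekopa_Leindler_PiM[OF l finite_Basis]) (use le T in auto)
qed

section \<open>Concentration of intrinsic volumes\<close>

lemma sum_conic_intrinsic_volume:
  fixes C :: "(real^'d) set"
  assumes "closed_convex_cone C"
  shows "(\<Sum>k\<le>CARD('d). conic_intrinsic_volume k C) = 1"
proof -
  interpret prob_space "std_gaussian :: (real^'d) measure" by (rule prob_space_std_gaussian)
  have "proj_mgf C 1 = 1"
    using emeasure_space_1 by (simp add: proj_mgf_def tilt_def)
  then show ?thesis using proj_mgf_eq(2)[OF assms, of 1] by (simp add: ennreal_eq_1)
qed

lemma pmf_intrinsic_volume:
  fixes C :: "(real^'d) set"
  assumes "closed_convex_cone C"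
  shows "pmf (intrinsic_volume_pmf C) k = (if k \<le> CARD('d) then conic_intrinsic_volume k C else 0)"
  unfolding intrinsic_volume_pmf_def
proof (rule pmf_embed_pmf)
  let ?f = "\<lambda>k. if k \<le> CARD('d) then conic_intrinsic_volume k C else 0"
  show "0 \<le> ?f k" for k using proj_mgf_eq(1)[OF assms] by simp
  have "(\<integral>\<^sup>+k. ennreal (?f k) \<partial>count_space UNIV) = (\<Sum>k\<le>CARD('d). ennreal (?f k))"
    by (subst nn_integral_count_space'[of "{..CARD('d)}"]) auto
  also have "\<dots> = (\<Sum>k\<le>CARD('d). ennreal (conic_intrinsic_volume k C))" by (intro sum.cong) auto
  also have "\<dots> = 1"
    using sum_conic_intrinsic_volume[OF assms] proj_mgf_eq(1)[OF assms] by (subst sum_ennreal) auto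
  finally show "(\<integral>\<^sup>+k. ennreal (?f k) \<partial>count_space UNIV) = 1" .
qed

lemma expectation_intrinsic_volume:
  fixes C :: "(real^'d) set" and f :: "nat \<Rightarrow> real"
  assumes "closed_convex_cone C"
  shows "measure_pmf.expectation (intrinsic_volume_pmf C) f = (\<Sum>k\<le>CARD('d). conic_intrinsic_volume k C * f k)"
proof -
  have "measure_pmf.expectation (intrinsic_volume_pmf C) f =
      (\<Sum>k\<le>CARD('d). f k * pmf (intrinsic_volume_pmf C) k)"
    by (rule integral_measure_pmf_real) (auto simp: set_pmf_iff pmf_intrinsic_volume[OF assms] split: if_splits)
  then show ?thesis by (simp add: pmf_intrinsic_volume[OF assms] mult.commute)
qed

lemma conic_intrinsic_volume_polar:
  fixes C :: "(real^'d) set"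
  assumes C: "closed_convex_cone C" and k: "k \<le> CARD('d)"
  shows "conic_intrinsic_volume k (polar_cone C) = conic_intrinsic_volume (CARD('d) - k) C"
proof (rule ennreal_polynomial_coefficients_eq[OF _ _ _ k])
  fix s :: real assume s: "0 < s"
  have "ennreal (\<Sum>k\<le>CARD('d). conic_intrinsic_volume k (polar_cone C) * s ^ k) =
      ennreal (s ^ CARD('d)) * ennreal (\<Sum>k\<le>CARD('d). conic_intrinsic_volume k C * (1 / s) ^ k)"
    using proj_mgf_eq(2)[OF closed_convex_cone_polar[of C] s] proj_mgf_polar[OF C s] proj_mgf_eq(2)[OF C, of "1 / s"] s
    by simp
  also have "\<dots> = ennreal (\<Sum>k\<le>CARD('d). s ^ CARD('d) * (conic_intrinsic_volume k C * (1 / s) ^ k))"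
    using s by (simp add: sum_distrib_left flip: ennreal_mult')
  also have "(\<Sum>k\<le>CARD('d). s ^ CARD('d) * (conic_intrinsic_volume k C * (1 / s) ^ k)) =
      (\<Sum>k\<le>CARD('d). conic_intrinsic_volume k C * s ^ (CARD('d) - k))"
    using s by (intro sum.cong) (auto simp: power_diff power_divide)
  also have "\<dots> = (\<Sum>k\<le>CARD('d). conic_intrinsic_volume (CARD('d) - k) C * s ^ k)"
    by (rule sum.reindex_bij_witness[of _ "\<lambda>k. CARD('d) - k" "\<lambda>k. CARD('d) - k"]) auto
  finally show "ennreal (\<Sum>k\<le>CARD('d). conic_intrinsic_volume k (polar_cone C) * s ^ k) =
      ennreal (\<Sum>k\<le>CARD('d). conic_intrinsic_volume (CARD('d) - k) C * s ^ k)" .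
qed (use proj_mgf_eq(1)[OF C] proj_mgf_eq(1)[OF closed_convex_cone_polar] in auto)

lemma expectation_intrinsic_volume_polar:
  fixes C :: "(real^'d) set" and f :: "nat \<Rightarrow> real"
  assumes C: "closed_convex_cone C"
  shows "measure_pmf.expectation (intrinsic_volume_pmf (polar_cone C)) f =
    measure_pmf.expectation (intrinsic_volume_pmf C) (\<lambda>k. f (CARD('d) - k))"
  unfolding expectation_intrinsic_volume[OF C] expectation_intrinsic_volume[OF closed_convex_cone_polar]
  by (rule sum.reindex_bij_witness[of _ "\<lambda>k. CARD('d) - k" "\<lambda>k. CARD('d) - k"])
    (auto simp: conic_intrinsic_volume_polar[OF C])

lemma statistical_dimension_eq:
  fixes C :: "(real^'d) set"
  assumes "closed_convex_cone C"
  shows "statistical_dimension C = (\<Sum>k\<le>CARD('d). conic_intrinsic_volume k C * real k)"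
  unfolding statistical_dimension_def by (rule expectation_intrinsic_volume[OF assms])

lemma statistical_dimension_polar:
  fixes C :: "(real^'d) set"
  assumes C: "closed_convex_cone C"
  shows "statistical_dimension (polar_cone C) = real CARD('d) - statistical_dimension C"
proof -
  have "statistical_dimension (polar_cone C) = (\<Sum>k\<le>CARD('d). conic_intrinsic_volume k C * real (CARD('d) - k))"
    unfolding statistical_dimension_def expectation_intrinsic_volume_polar[OF C]
    by (rule expectation_intrinsic_volume[OF C])
  also have "\<dots> = real CARD('d) * (\<Sum>k\<le>CARD('d). conic_intrinsic_volume k C)
      - (\<Sum>k\<le>CARD('d). conic_intrinsic_volume k C * real k)"
    unfolding sum_distrib_left sum_subtractf[symmetric]
    by (intro sum.cong) (auto simp: of_nat_diff algebra_simps)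
  finally show ?thesis by (simp add: sum_conic_intrinsic_volume[OF C] statistical_dimension_eq[OF C])
qed

section \<open>Logarithmic bounds for the generating polynomial\<close>

definition intrinsic_volume_poly :: "(real^'d) set \<Rightarrow> real \<Rightarrow> real" where
  "intrinsic_volume_poly C s = (\<Sum>k\<le>CARD('d). conic_intrinsic_volume k C * s ^ k)"

lemma tilt_le_ln:
  assumes "0 < s" shows "tilt s \<le> ln s"
proof -
  have "ln (1 / s\<^sup>2) \<le> 1 / s\<^sup>2 - 1" using assms by (intro ln_le_minus_one) auto
  then show ?thesis using assms by (simp add: tilt_def ln_div ln_realpow)
qed

lemma tilt_lt_half: "0 < s \<Longrightarrow> tilt s < 1 / 2"
  by (simp add: tilt_def)

lemma exists_tilt:
  assumes "\<xi> < 1 / 2"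
  obtains s where "0 < s" "tilt s = \<xi>"
proof
  show "0 < 1 / sqrt (1 - 2 * \<xi>)" "tilt (1 / sqrt (1 - 2 * \<xi>)) = \<xi>"
    using assms by (simp_all add: tilt_def power_divide)
qed

text \<open>Jensen on the discrete side: the mean of \<open>s ^ k\<close> is at least
  \<open>s\<close> to the power \<delta>, and \<open>tilt s \<le> ln s\<close> makes this linear in
  the tilt. The identification of \<delta> with the mean squared length of the projection is thereby
  avoided.\<close>

lemma intrinsic_volume_poly_ge:
  fixes C :: "(real^'d) set"
  assumes C: "closed_convex_cone C" and s: "0 < s"
  shows "0 < intrinsic_volume_poly C s"
    and "statistical_dimension C * tilt s \<le> ln (intrinsic_volume_poly C s)"
proof -
  let ?v = "\<lambda>k. conic_intrinsic_volume k C" and ?\<delta> = "statistical_dimension C"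
  have v: "0 \<le> ?v k" if "k \<le> CARD('d)" for k using proj_mgf_eq(1)[OF C that] .
  define m where "m = ?\<delta> * ln s"
  \<comment> \<open>The tangent to the exponential at \<open>m\<close>, the mean of
    \<open>real k * ln s\<close>; its linear part averages out, so the sum equals 1.\<close>
  have "(\<Sum>k\<le>CARD('d). ?v k * (1 + (real k * ln s - m))) =
      (1 - m) * (\<Sum>k\<le>CARD('d). ?v k) + ln s * (\<Sum>k\<le>CARD('d). ?v k * real k)"
    unfolding sum_distrib_left sum.distrib[symmetric] by (intro sum.cong) (auto simp: algebra_simps)
  then have "exp m = exp m * (\<Sum>k\<le>CARD('d). ?v k * (1 + (real k * ln s - m)))"
    by (simp add: sum_conic_intrinsic_volume[OF C] m_def statistical_dimension_eq[OF C])
  also have "\<dots> \<le> exp m * (\<Sum>k\<le>CARD('d). ?v k * exp (real k * ln s - m))"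
    using v by (intro mult_left_mono sum_mono) auto
  also have "\<dots> = intrinsic_volume_poly C s"
    using s by (auto simp: intrinsic_volume_poly_def sum_distrib_left exp_diff exp_of_nat_mult intro!: sum.cong)
  finally have ge: "exp m \<le> intrinsic_volume_poly C s" .
  then show pos: "0 < intrinsic_volume_poly C s" by (rule less_le_trans[OF exp_gt_zero])
  have "0 \<le> ?\<delta>" unfolding statistical_dimension_eq[OF C] using v by (intro sum_nonneg) auto
  then have "?\<delta> * tilt s \<le> m" unfolding m_def by (intro mult_left_mono tilt_le_ln s)
  also have "m \<le> ln (intrinsic_volume_poly C s)" using ge pos by (simp add: ln_ge_iff)
  finally show "?\<delta> * tilt s \<le> ln (intrinsic_volume_poly C s)" .
qed

lemma proj_mgf_eq_poly:
  assumes "closed_convex_cone C" "0 < s"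
  shows "proj_mgf C s = ennreal (intrinsic_volume_poly C s)"
  using proj_mgf_eq(2)[OF assms] by (simp add: intrinsic_volume_poly_def)

lemma geo_mean_le_ennreal:
  assumes "0 < l" "l < 1" "p powr (1 - l) * q powr l \<le> r"
  shows "geo_mean_le l (ennreal p) (ennreal q) (ennreal r)"
  unfolding geo_mean_le_def
proof safe
  fix a b :: real assume ab: "0 < a" "0 < b" "ennreal a < ennreal p" "ennreal b < ennreal q"
  then have "a powr (1 - l) * b powr l \<le> p powr (1 - l) * q powr l"
    using assms by (intro mult_mono powr_mono2) (auto simp: ennreal_less_iff)
  then show "ennreal (a powr (1 - l) * b powr l) \<le> ennreal r"
    using assms by (intro ennreal_leI) simp
qed

text \<open>\<open>geo_mean_le\<close> speaks of strict minorants, so \<open>p\<close> and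
  \<open>q\<close> are shrunk by \<open>exp (- e)\<close>; as the weights add up to 1, this costs
  exactly \<open>e\<close>.\<close>

lemma geo_mean_le_ennrealD:
  assumes l: "0 < l" "l < 1" and pq: "0 < p" "0 < q" and le: "geo_mean_le l (ennreal p) (ennreal q) 1"
  shows "(1 - l) * ln p + l * ln q \<le> 0"
proof (rule field_le_epsilon)
  fix e :: real assume e: "0 < e"
  define c where "c = exp (- e)"
  have c: "0 < c" "c < 1" using e by (auto simp: c_def)
  have "ennreal ((c * p) powr (1 - l) * (c * q) powr l) \<le> 1"
    using le c pq unfolding geo_mean_le_def by (auto simp: ennreal_less_iff)
  then have "(c * p) powr (1 - l) * (c * q) powr l \<le> 1"
    by (simp add: ennreal_le_1)
  also have "(c * p) powr (1 - l) * (c * q) powr l = exp ((1 - l) * (ln p - e) + l * (ln q - e))"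
    using c pq by (simp add: powr_def ln_mult c_def exp_add)
  finally show "(1 - l) * ln p + l * ln q \<le> 0 + e" by (simp add: algebra_simps)
qed

text \<open>Completing the square, with equality at \<open>w = 2 * a * r\<close>. The coefficient is
  the one whose reciprocal is \<open>1 / a + 2\<close>.\<close>

lemma quadratic_inf_convolution:
  fixes a r w :: real
  assumes "0 < a"
  shows "a / (1 + 2 * a) * (r + w)\<^sup>2 \<le> a * r\<^sup>2 + w\<^sup>2 / 2"
proof -
  have "(1 + 2 * a) * (a * r\<^sup>2 + w\<^sup>2 / 2) - a * (r + w)\<^sup>2 = (2 * a * r - w)\<^sup>2 / 2"
    by (simp add: power2_eq_square algebra_simps)
  then have "a * (r + w)\<^sup>2 \<le> (1 + 2 * a) * (a * r\<^sup>2 + w\<^sup>2 / 2)"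
    using zero_le_power2[of "2 * a * r - w"] by linarith
  then show ?thesis using assms by (simp add: field_simps)
qed

text \<open>Prekopa--Leindler for Gaussian weights: the strict concavity of the logarithm of the density
  leaves room for a quadratic cost, and the squared length of the projection satisfies the
  corresponding cost inequality because the projection is a contraction.\<close>

lemma ln_intrinsic_volume_poly_le:
  fixes C :: "(real^'d) set"
  assumes C: "closed_convex_cone C" and l: "0 < l" "l < 1" and a: "0 < a" and st: "0 < s" "0 < t"
    and tilt: "tilt s = l * (a / (1 + 2 * a))" "tilt t = - (1 - l) * a"
  shows "(1 - l) * ln (intrinsic_volume_poly C s) + l * ln (intrinsic_volume_poly C t) \<le> 0"
proof -
  note [measurable] = closest_point_cone_measurable[OF C]
  let ?Z = "\<lambda>x. (norm (closest_point C x))\<^sup>2"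
  let ?u = "\<lambda>r x. gauss_density x * exp (tilt r * ?Z x)"
  define K where "K = (1 / sqrt (2 * pi)) ^ DIM(real^'d)"
  have K: "0 < K" by (simp add: K_def)
  have "gauss_density x = K * exp (- (norm x)\<^sup>2 / 2)" for x :: "real^'d"
    by (simp add: gauss_density_def K_def)
  then have g: "gauss_density x = exp (ln K - (norm x)\<^sup>2 / 2)" for x :: "real^'d"
    unfolding diff_conv_add_uminus exp_add using K by simp
  have u: "?u r x = exp (ln K - (norm x)\<^sup>2 / 2 + tilt r * ?Z x)" for r and x :: "real^'d"
    by (simp only: g exp_add)
  have point: "?u s x powr (1 - l) * ?u t y powr l \<le> gauss_density ((1 - l) *\<^sub>R x + l *\<^sub>R y)" for x y :: "real^'d"
  proof -
    define b where "b = a / (1 + 2 * a)"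
    define z where "z = (1 - l) *\<^sub>R x + l *\<^sub>R y"
    have z: "(norm z)\<^sup>2 = (1 - l) * (norm x)\<^sup>2 + l * (norm y)\<^sup>2 - l * (1 - l) * (norm (x - y))\<^sup>2"
      unfolding z_def power2_norm_eq_inner
      by (simp add: inner_diff_left inner_diff_right inner_add_left inner_add_right inner_commute[of y x] algebra_simps)
    have "norm (closest_point C x) \<le> norm (closest_point C y) + norm (x - y)"
      using closest_point_cone_lipschitz[OF C, of x y] norm_triangle_sub[of "closest_point C x" "closest_point C y"]
      by linarith
    then have "?Z x \<le> (norm (closest_point C y) + norm (x - y))\<^sup>2" by (intro power_mono) auto
    then have "b * ?Z x \<le> b * (norm (closest_point C y) + norm (x - y))\<^sup>2"
      using a by (intro mult_left_mono) (auto simp: b_def)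
    also have "\<dots> \<le> a * ?Z y + (norm (x - y))\<^sup>2 / 2" unfolding b_def by (rule quadratic_inf_convolution[OF a])
    \<comment> \<open>The weight \<open>l * (1 - l)\<close> is that of the squared distance in the
      expansion of \<open>norm z\<close>. It dictates the two tilts: the left side is
      \<open>(1 - l) * tilt s * ?Z x\<close>, and the first term on the right is
      \<open>- l * tilt t * ?Z y\<close>.\<close>
    finally have "l * (1 - l) * (b * ?Z x) \<le> l * (1 - l) * (a * ?Z y + (norm (x - y))\<^sup>2 / 2)"
      using l by (intro mult_left_mono) auto
    then have "(1 - l) * (ln K - (norm x)\<^sup>2 / 2 + tilt s * ?Z x) + l * (ln K - (norm y)\<^sup>2 / 2 + tilt t * ?Z y)
        \<le> ln K - (norm z)\<^sup>2 / 2"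
      unfolding z tilt b_def[symmetric]
      by (simp add: algebra_simps add_divide_distrib diff_divide_distrib)
    then show ?thesis
      unfolding u g z_def[symmetric] by (simp add: powr_def flip: exp_add)
  qed
  have "geo_mean_le l (\<integral>\<^sup>+x. ennreal (?u s x) \<partial>lborel) (\<integral>\<^sup>+x. ennreal (?u t x) \<partial>lborel)
      (\<integral>\<^sup>+x. ennreal (gauss_density (x::real^'d)) \<partial>lborel)"
    by (intro Prekopa_Leindler[OF l] geo_mean_le_ennreal l point) measurable
  moreover have "(\<integral>\<^sup>+x. ennreal (?u r x) \<partial>lborel) = proj_mgf C r" for r
    unfolding proj_mgf_def by (subst nn_integral_std_gaussian) (auto simp: ennreal_mult')
  ultimately have "geo_mean_le l (proj_mgf C s) (proj_mgf C t) 1" by (simp add: nn_integral_gauss_density)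
  then show ?thesis
    using intrinsic_volume_poly_ge(1)[OF C] st l
    by (intro geo_mean_le_ennrealD) (simp_all add: proj_mgf_eq_poly[OF C])
qed

proposition ln_intrinsic_volume_poly_bound:
  fixes C :: "(real^'d) set"
  assumes C: "closed_convex_cone C" and s: "0 < s"
  shows "ln (intrinsic_volume_poly C s) * (1 - 2 * tilt s) \<le> statistical_dimension C * tilt s"
proof -
  let ?L = "\<lambda>s. ln (intrinsic_volume_poly C s)" and ?\<delta> = "statistical_dimension C"
  define \<xi> where "\<xi> = tilt s"
  have \<xi>: "\<xi> < 1 / 2" using tilt_lt_half[OF s] by (simp add: \<xi>_def)
  \<comment> \<open>The claim with \<open>m < 1\<close> in place of 1, since Prekopa-Leindler needs
    both weights positive. The weight \<open>l\<close> is \<open>m\<close> for positive \<xi> and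
    \<open>1 - m\<close> for negative \<xi>.\<close>
  have *: "?L s * (m - 2 * \<xi>) \<le> ?\<delta> * \<xi> * m" if m: "0 < m" "2 * \<xi> < m" "m < 1" for m
  proof -
    consider "\<xi> = 0" | "0 < \<xi>" | "\<xi> < 0" by linarith
    then show ?thesis
    proof cases
      assume "\<xi> = 0"
      then have "s\<^sup>2 = 1" using s by (simp add: \<xi>_def tilt_def)
      then have "s = 1" using s by (simp add: power2_eq_1_iff)
      then show ?thesis using sum_conic_intrinsic_volume[OF C] \<open>\<xi> = 0\<close> by (simp add: intrinsic_volume_poly_def)
    next
      assume pos: "0 < \<xi>"
      \<comment> \<open>The solution of \<open>m * (a / (1 + 2 * a)) = \<xi>\<close>, positive
        because \<open>2 * \<xi> < m\<close>. The companion tilt \<open>- (1 - m) * a\<close>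
        carries the factor \<open>1 - m\<close>, which cancels against the weight of
        \<open>?L s\<close>.\<close>
      define a where "a = \<xi> / (m - 2 * \<xi>)"
      have a: "0 < a" using pos m by (simp add: a_def)
      have "1 + 2 * a = m / (m - 2 * \<xi>)" using m by (simp add: a_def field_simps)
      then have eq: "tilt s = m * (a / (1 + 2 * a))" using m by (simp add: a_def flip: \<xi>_def)
      have "0 \<le> (1 - m) * a" using a m by simp
      then have "- (1 - m) * a < 1 / 2" unfolding mult_minus_left by linarith
      then obtain t where t: "0 < t" "tilt t = - (1 - m) * a" using exists_tilt by blast
      have "(1 - m) * ?L s \<le> - (m * ?L t)"
        using ln_intrinsic_volume_poly_le[OF C m(1,3) a s t(1) eq t(2)] by simp
      also have "m * (?\<delta> * tilt t) \<le> m * ?L t"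
        using intrinsic_volume_poly_ge(2)[OF C t(1)] m by (intro mult_left_mono) auto
      then have "- (m * ?L t) \<le> (1 - m) * (m * ?\<delta> * a)" by (simp add: t(2) algebra_simps)
      finally have "?L s \<le> m * ?\<delta> * a" using m by simp
      then have "?L s * (m - 2 * \<xi>) \<le> m * ?\<delta> * a * (m - 2 * \<xi>)" using m by (intro mult_right_mono) auto
      then show ?thesis using m by (simp add: a_def mult_ac)
    next
      assume neg: "\<xi> < 0"
      \<comment> \<open>Here \<open>s\<close> and \<open>t\<close> exchange roles: the given tilt is
        the negative one, so \<open>a\<close> solves \<open>- m * a = \<xi>\<close>, and Jensen
        bounds the factor with the positive tilt \<open>(1 - m) * b\<close>.\<close>
      define a where "a = - \<xi> / m"
      have a: "0 < a" using neg m by (simp add: a_def divide_neg_pos)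
      define b where "b = a / (1 + 2 * a)"
      have b: "0 < b" "b < 1 / 2" using a by (simp_all add: b_def field_simps)
      have "(1 - m) * b \<le> 1 * b" using b m by (intro mult_right_mono) auto
      then have "(1 - m) * b < 1 / 2" using b(2) by linarith
      then obtain t where t: "0 < t" "tilt t = (1 - m) * b" using exists_tilt by blast
      have t': "tilt t = (1 - m) * (a / (1 + 2 * a))" using t(2) by (simp only: b_def)
      have s': "tilt s = - (1 - (1 - m)) * a" using m by (simp add: a_def flip: \<xi>_def)
      have "(1 - (1 - m)) * ?L t + (1 - m) * ?L s \<le> 0"
        by (rule ln_intrinsic_volume_poly_le[OF C _ _ a t(1) s t' s']) (use m in auto)
      moreover have "m * (?\<delta> * tilt t) \<le> m * ?L t"
        using intrinsic_volume_poly_ge(2)[OF C t(1)] m by (intro mult_left_mono) auto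
      ultimately have "(1 - m) * ?L s \<le> (1 - m) * (- (m * ?\<delta> * b))" by (simp add: t(2) algebra_simps)
      then have "?L s \<le> - (m * ?\<delta> * b)" by (rule mult_left_le_imp_le) (use m in simp)
      then have "?L s * (m - 2 * \<xi>) \<le> - (m * ?\<delta> * b) * (m - 2 * \<xi>)" using neg m by (intro mult_right_mono) auto
      also have "b * (m - 2 * \<xi>) = - \<xi>"
      proof -
        have "1 + 2 * a = (m - 2 * \<xi>) / m" using m by (simp add: a_def field_simps)
        then show ?thesis using m neg by (simp add: b_def a_def)
      qed
      then have "- (m * ?\<delta> * b) * (m - 2 * \<xi>) = ?\<delta> * \<xi> * m" by (simp add: mult.assoc)
      finally show ?thesis .
    qed
  qed
  have "?L s * (1 - 2 * \<xi>) \<le> ?\<delta> * \<xi> * 1"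
  proof (rule tendsto_le[OF trivial_limit_at_left_real])
    show "((\<lambda>m. ?\<delta> * \<xi> * m) \<longlongrightarrow> ?\<delta> * \<xi> * 1) (at_left 1)"
      "((\<lambda>m. ?L s * (m - 2 * \<xi>)) \<longlongrightarrow> ?L s * (1 - 2 * \<xi>)) (at_left 1)"
      by (intro tendsto_intros)+
    have "max 0 (2 * \<xi>) < 1" using \<xi> by simp
    then show "\<forall>\<^sub>F m in at_left 1. ?L s * (m - 2 * \<xi>) \<le> ?\<delta> * \<xi> * m"
      using * by (auto simp: eventually_at_left_field intro!: exI[of _ "max 0 (2 * \<xi>)"])
  qed
  then show ?thesis by (simp add: \<xi>_def)
qed

lemma intrinsic_volume_mgf_bound:
  fixes C :: "(real^'d) set" and \<eta> :: real
  assumes C: "closed_convex_cone C"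
  shows "measure_pmf.expectation (intrinsic_volume_pmf C) (\<lambda>k. exp (\<eta> * (real k - statistical_dimension C)))
    \<le> exp ((exp (2 * \<eta>) - 2 * \<eta> - 1) / 2 * statistical_dimension C)"
proof -
  let ?\<delta> = "statistical_dimension C" and ?P = "intrinsic_volume_poly C (exp \<eta>)"
  have "exp (- 2 * \<eta>) = 1 / (exp \<eta>)\<^sup>2"
    by (simp add: exp_minus exp_double inverse_eq_divide)
  then have tilt: "tilt (exp \<eta>) = (1 - exp (- 2 * \<eta>)) / 2"
    by (simp add: tilt_def)
  have pos: "0 < ?P" by (rule intrinsic_volume_poly_ge(1)[OF C]) simp
  have "ln ?P * exp (- 2 * \<eta>) \<le> ?\<delta> * ((1 - exp (- 2 * \<eta>)) / 2)"
    using ln_intrinsic_volume_poly_bound[OF C, of "exp \<eta>"] by (simp add: tilt field_simps)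
  then have "ln ?P * exp (- 2 * \<eta>) * exp (2 * \<eta>) \<le> ?\<delta> * ((1 - exp (- 2 * \<eta>)) / 2) * exp (2 * \<eta>)"
    by (intro mult_right_mono) auto
  then have "ln ?P \<le> ?\<delta> * ((exp (2 * \<eta>) - 1) / 2)"
    by (simp add: algebra_simps diff_divide_distrib flip: exp_add)
  then have "?P \<le> exp (?\<delta> * ((exp (2 * \<eta>) - 1) / 2))" 
    using pos by (metis exp_le_cancel_iff exp_ln)
  then have "?P * exp (- \<eta> * ?\<delta>) \<le> exp (?\<delta> * ((exp (2 * \<eta>) - 1) / 2)) * exp (- \<eta> * ?\<delta>)"
    by (intro mult_right_mono) auto
  also have "\<dots> = exp ((exp (2 * \<eta>) - 2 * \<eta> - 1) / 2 * ?\<delta>)"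
    by (simp add: algebra_simps diff_divide_distrib flip: exp_add)
  also have "?P * exp (- \<eta> * ?\<delta>) =
      measure_pmf.expectation (intrinsic_volume_pmf C) (\<lambda>k. exp (\<eta> * (real k - ?\<delta>)))"
    unfolding expectation_intrinsic_volume[OF C] intrinsic_volume_poly_def sum_distrib_right
    by (intro sum.cong) (auto simp: algebra_simps exp_of_nat_mult[symmetric] simp flip: exp_add)
  finally show ?thesis .
qed

theorem theorem4p8:
  fixes C :: "(real ^ 'd) set" and \<eta> :: real
  assumes "closed_convex_cone C"
  shows "measure_pmf.expectation (intrinsic_volume_pmf C)
             (\<lambda>k. exp (\<eta> * (real k - statistical_dimension C)))
           \<le> exp ((exp (2 * \<eta>) - 2 * \<eta> - 1) / 2 * statistical_dimension C)
       \<and> measure_pmf.expectation (intrinsic_volume_pmf C)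
             (\<lambda>k. exp (\<eta> * (real k - statistical_dimension C)))
           \<le> exp ((exp (- 2 * \<eta>) + 2 * \<eta> - 1) / 2 * statistical_dimension (polar_cone C))"
proof
  \<comment> \<open>Polarity reverses the law and sends \<delta> to its complement in the dimension,
    so the centred variable only changes sign. The second bound is therefore the first one for the
    polar cone at \<open>- \<eta>\<close>.\<close>
  have "measure_pmf.expectation (intrinsic_volume_pmf C) (\<lambda>k. exp (\<eta> * (real k - statistical_dimension C))) =
      measure_pmf.expectation (intrinsic_volume_pmf (polar_cone C))
        (\<lambda>k. exp (- \<eta> * (real k - statistical_dimension (polar_cone C))))"
    unfolding expectation_intrinsic_volume_polar[OF assms] expectation_intrinsic_volume[OF assms]
      statistical_dimension_polar[OF assms]
    by (intro sum.cong) (auto simp: of_nat_diff algebra_simps)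
  also have "\<dots> \<le> exp ((exp (2 * - \<eta>) - 2 * - \<eta> - 1) / 2 * statistical_dimension (polar_cone C))"
    by (rule intrinsic_volume_mgf_bound[OF closed_convex_cone_polar])
  finally show "measure_pmf.expectation (intrinsic_volume_pmf C)
             (\<lambda>k. exp (\<eta> * (real k - statistical_dimension C)))
           \<le> exp ((exp (- 2 * \<eta>) + 2 * \<eta> - 1) / 2 * statistical_dimension (polar_cone C))"
    by simp
qed (rule intrinsic_volume_mgf_bound[OF assms])

end
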